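(* Let $\mathbb{K}$ be an algebraically closed field of characteristic zero, let $n\ge 1$, and let $L\subseteq W_n(\mathbb{K})$ be a polynomial Lie algebra of rank one. Let $F\subset L$ be a finite-dimensional (over $\mathbb{K}$) Lie subalgebra. Then one of the following conditions holds: (1) $F$ is abelian; (2) $F\cong A\rtimes\langle b\rangle$, where $b\in F$, $A\subset F$ is an abelian ideal, and $[b,a]=a$ for every $a\in A$; (3) $F$ is a three-dimensional simple Lie algebra, i.e. $F\cong\mathfrak{sl}_2(\mathbb{K})$.
   Context: $\mathbb{K}[X]:=\mathbb{K}[x_1,\ldots,x_n]$ is the polynomial algebra, and $W_n(\mathbb{K})$ is the Lie algebra over $\mathbb{K}$ of all $\mathbb{K}$-linear derivations of $\mathbb{K}[X]$ with the commutator bracket; it is a free $\mathbb{K}[X]$-module with basis $\frac{\partial}{\partial x_1},\ldots,\frac{\partial}{\partial x_n}$. A polynomial Lie algebra is a Lie subalgebra $L\subseteq W_n(\mathbb{K})$ that is also a $\mathbb{K}[X]$-submodule of $W_n(\mathbb{K})$. Its rank is its rank as a $\mathbb{K}[X]$-module, i.e. the maximal number of elements of $L$ linearly independent over $\mathbb{K}[X]$. $\langle b\rangle$ denotes the one-dimensional $\mathbb{K}$-span of $b$, and $A\rtimes\langle b\rangle$ denotes the semidirect product of Lie algebras with ideal $A$. *)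

theory Defs
  imports
    "HOL-Analysis.Analysis"
    "HOL-Library.Poly_Mapping"
    "HOL-Computational_Algebra.Computational_Algebra"
begin

section \<open>Lie algebras\<close>

text \<open>Subalgebras, ideals etc. are subsets of an ambient Lie algebra that occupies a whole type.\<close>

locale lie_algebra = vector_space scale
  for scale :: "'k::field \<Rightarrow> 'v::ab_group_add \<Rightarrow> 'v" +
  fixes bracket :: "'v \<Rightarrow> 'v \<Rightarrow> 'v"
  assumes bracket_add_left: "bracket (x + y) z = bracket x z + bracket y z"
    and bracket_add_right: "bracket x (y + z) = bracket x y + bracket x z"
    and bracket_scale_left: "bracket (scale c x) y = scale c (bracket x y)"
    and bracket_scale_right: "bracket x (scale c y) = scale c (bracket x y)"
    and bracket_self: "bracket x x = 0"
    and jacobi: "bracket x (bracket y z) + bracket y (bracket z x) + bracket z (bracket x y) = 0"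
begin

definition finite_dim :: "'v set \<Rightarrow> bool" where
  "finite_dim S \<longleftrightarrow> (\<exists>B. finite B \<and> span B = S)"

definition subalgebra :: "'v set \<Rightarrow> bool" where
  "subalgebra S \<longleftrightarrow> subspace S \<and> (\<forall>x\<in>S. \<forall>y\<in>S. bracket x y \<in> S)"

definition lie_ideal :: "'v set \<Rightarrow> 'v set \<Rightarrow> bool" where
  "lie_ideal I S \<longleftrightarrow> subspace I \<and> I \<subseteq> S \<and> (\<forall>x\<in>S. \<forall>a\<in>I. bracket x a \<in> I)"

definition abelian :: "'v set \<Rightarrow> bool" where
  "abelian S \<longleftrightarrow> (\<forall>x\<in>S. \<forall>y\<in>S. bracket x y = 0)"

definition simple :: "'v set \<Rightarrow> bool" where
  "simple S \<longleftrightarrow> subalgebra S \<and> \<not> abelian S \<and> (\<forall>I. lie_ideal I S \<longrightarrow> I = {0} \<or> I = S)"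

text \<open>\<open>S\<close> is the (internal) semidirect product of the ideal \<open>A\<close> and the subalgebra \<open>B\<close>.\<close>

definition semidirect :: "'v set \<Rightarrow> 'v set \<Rightarrow> 'v set \<Rightarrow> bool" where
  "semidirect S A B \<longleftrightarrow>
     lie_ideal A S \<and> subalgebra B \<and> B \<subseteq> S \<and> A \<inter> B = {0} \<and> S = {a + b |a b. a \<in> A \<and> b \<in> B}"

end

definition lie_isomorphic ::
  "('k::field \<Rightarrow> 'v::ab_group_add \<Rightarrow> 'v) \<Rightarrow> ('v \<Rightarrow> 'v \<Rightarrow> 'v) \<Rightarrow> 'v set \<Rightarrow>
   ('k \<Rightarrow> 'w::ab_group_add \<Rightarrow> 'w) \<Rightarrow> ('w \<Rightarrow> 'w \<Rightarrow> 'w) \<Rightarrow> 'w set \<Rightarrow> bool" where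
  "lie_isomorphic scale1 bracket1 S scale2 bracket2 T \<longleftrightarrow>
     (\<exists>\<phi>. bij_betw \<phi> S T \<and>
        (\<forall>x\<in>S. \<forall>y\<in>S. \<phi> (x + y) = \<phi> x + \<phi> y) \<and>
        (\<forall>c. \<forall>x\<in>S. \<phi> (scale1 c x) = scale2 c (\<phi> x)) \<and>
        (\<forall>x\<in>S. \<forall>y\<in>S. \<phi> (bracket1 x y) = bracket2 (\<phi> x) (\<phi> y)))"


section \<open>The Lie algebra of two by two matrices of trace zero\<close>

definition mat_scale :: "'k::field \<Rightarrow> 'k^'m^'m \<Rightarrow> 'k^'m^'m" where
  "mat_scale c = map_matrix ((*) c)"

definition mat_bracket :: "'k::field^'m^'m \<Rightarrow> 'k^'m^'m \<Rightarrow> 'k^'m^'m" where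
  "mat_bracket A B = A ** B - B ** A"

definition sl2 :: "('k::field^2^2) set" where
  "sl2 = {A. trace A = 0}"

lemma mat_scale_mult:
  "mat_scale c A ** B = mat_scale c (A ** B)" "A ** mat_scale c B = mat_scale c (A ** B)"
  by (simp_all add: mat_scale_def vec_eq_iff matrix_matrix_mult_def sum_distrib_left mult_ac)

lemma mat_scale_diff: "mat_scale c (A - B) = mat_scale c A - mat_scale c B"
  by (simp add: mat_scale_def vec_eq_iff algebra_simps)

lemma mat_mult_distrib:
  fixes A B C :: "'k::field^'m^'m"
  shows "(A + B) ** C = A ** C + B ** C" "C ** (A + B) = C ** A + C ** B"
    "(A - B) ** C = A ** C - B ** C" "C ** (A - B) = C ** A - C ** B"
  by (simp_all add: vec_eq_iff matrix_matrix_mult_def sum.distrib sum_subtractf algebra_simps)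

global_interpretation gl: lie_algebra "mat_scale :: 'k::field \<Rightarrow> 'k^'m^'m \<Rightarrow> 'k^'m^'m" mat_bracket
  by unfold_locales
    (simp_all add: mat_bracket_def mat_scale_mult
      mat_scale_diff mat_mult_distrib matrix_mul_assoc,
     simp_all add: mat_scale_def vec_eq_iff algebra_simps)


section \<open>Derivations of the polynomial algebra\<close>

text \<open>Polynomials over \<open>'k\<close> in variables indexed by \<open>'n\<close>: a finitely supported map from exponent
vectors to coefficients, with the convolution product. For \<open>n\<close> variables take
\<open>CARD('n) = n\<close>.\<close>

type_synonym ('n, 'k) mpoly = "('n \<Rightarrow>\<^sub>0 nat) \<Rightarrow>\<^sub>0 'k"

definition Const :: "'k::field \<Rightarrow> ('n::finite, 'k) mpoly" where
  "Const c = Poly_Mapping.single 0 c"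

definition is_derivation :: "(('n::finite, 'k::field) mpoly \<Rightarrow> ('n, 'k) mpoly) \<Rightarrow> bool" where
  "is_derivation D \<longleftrightarrow>
     (\<forall>p q. D (p + q) = D p + D q) \<and>
     (\<forall>c p. D (Const c * p) = Const c * D p) \<and>
     (\<forall>p q. D (p * q) = D p * q + p * D q)"

lemma Const_simps:
  "Const (a + b) = Const a + Const b" "Const (a * b) = Const a * Const b" "Const 1 = 1"
  by (simp_all add: Const_def single_add mult_single)

lemma is_derivation_iff:
  "is_derivation D \<longleftrightarrow>
     (\<forall>p q. D (p + q) = D p + D q) \<and> D 0 = 0 \<and> (\<forall>c. D (Const c) = 0) \<and>
     (\<forall>p q. D (p * q) = D p * q + p * D q)"
proof
  assume D: "is_derivation D"
  have 0: "D 0 = 0"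
    using D unfolding is_derivation_def by (metis add_cancel_right_right)
  have "D (1 * 1) = D 1 * 1 + 1 * D 1"
    using D unfolding is_derivation_def by blast
  then have 1: "D 1 = 0"
    by simp
  have "D (Const c * 1) = Const c * D 1" for c
    using D unfolding is_derivation_def by blast
  then have "D (Const c) = 0" for c
    using 1 by simp
  then show "(\<forall>p q. D (p + q) = D p + D q) \<and> D 0 = 0 \<and> (\<forall>c. D (Const c) = 0) \<and>
     (\<forall>p q. D (p * q) = D p * q + p * D q)"
    using D 0 unfolding is_derivation_def by blast
qed (simp add: is_derivation_def)

text \<open>The type of all derivations is \<open>W\<^sub>n(\<bbbK>)\<close>.\<close>

typedef (overloaded) ('n::finite, 'k::field) derivation =
  "{D :: ('n, 'k) mpoly \<Rightarrow> ('n, 'k) mpoly. is_derivation D}"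
  morphisms der_apply Derivation
  by (rule exI[of _ "\<lambda>_. 0"]) (simp add: is_derivation_iff)

setup_lifting type_definition_derivation

instantiation derivation :: (finite, field) ab_group_add
begin

lift_definition zero_derivation :: "('a, 'b) derivation" is "\<lambda>_. 0"
  by (simp add: is_derivation_iff)

lift_definition plus_derivation ::
  "('a, 'b) derivation \<Rightarrow> ('a, 'b) derivation \<Rightarrow> ('a, 'b) derivation" is "\<lambda>D E p. D p + E p"
  by (simp add: is_derivation_iff algebra_simps)

lift_definition uminus_derivation :: "('a, 'b) derivation \<Rightarrow> ('a, 'b) derivation" is "\<lambda>D p. - D p"
  by (simp add: is_derivation_iff algebra_simps)

lift_definition minus_derivation ::
  "('a, 'b) derivation \<Rightarrow> ('a, 'b) derivation \<Rightarrow> ('a, 'b) derivation" is "\<lambda>D E p. D p - E p"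
  by (simp add: is_derivation_iff algebra_simps)

instance
  by standard (transfer; simp add: fun_eq_iff algebra_simps)+

end

definition poly_scale ::
  "('n::finite, 'k::field) mpoly \<Rightarrow> ('n, 'k) derivation \<Rightarrow> ('n, 'k) derivation" where
  "poly_scale f D = Derivation (\<lambda>p. f * der_apply D p)"

definition der_scale :: "'k::field \<Rightarrow> ('n::finite, 'k) derivation \<Rightarrow> ('n, 'k) derivation" where
  "der_scale c = poly_scale (Const c)"

lift_definition der_bracket ::
  "('n::finite, 'k::field) derivation \<Rightarrow> ('n, 'k) derivation \<Rightarrow> ('n, 'k) derivation"
  is "\<lambda>D E p. D (E p) - E (D p)"
  by (simp add: is_derivation_iff algebra_simps)

lemma der_apply_is_derivation: "is_derivation (der_apply D)"
  using der_apply by auto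

lemma der_apply_simps:
  "der_apply D (p + q) = der_apply D p + der_apply D q"
  "der_apply D (Const c * p) = Const c * der_apply D p"
  "der_apply D (p * q) = der_apply D p * q + p * der_apply D q"
  using der_apply_is_derivation[of D] unfolding is_derivation_def by blast+

lemma der_apply_diff: "der_apply D (p - q) = der_apply D p - der_apply D q"
  using der_apply_simps(1)[of D "p - q" q] by (simp add: algebra_simps)

lemma derivation_eq_iff: "D = E \<longleftrightarrow> (\<forall>p. der_apply D p = der_apply E p)"
  by (metis der_apply_inject ext)

lemma der_apply_Const: "der_apply D 0 = 0" "der_apply D (Const c) = 0"
  using der_apply_is_derivation[of D] unfolding is_derivation_iff by blast+

lemma der_apply_poly_scale: "der_apply (poly_scale f D) p = f * der_apply D p"
proof -
  have "is_derivation (\<lambda>p. f * der_apply D p)"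
    by (simp add: is_derivation_iff der_apply_simps(1,3) der_apply_Const algebra_simps)
  then show ?thesis
    by (simp add: poly_scale_def Derivation_inverse)
qed

lemma der_apply_der_scale: "der_apply (der_scale c D) p = Const c * der_apply D p"
  by (simp add: der_scale_def der_apply_poly_scale)

lemmas der_apply_ops = zero_derivation.rep_eq plus_derivation.rep_eq uminus_derivation.rep_eq
  minus_derivation.rep_eq der_apply_poly_scale der_bracket.rep_eq der_apply_der_scale

global_interpretation W_mod: module
  "poly_scale :: ('n::finite, 'k::field) mpoly \<Rightarrow> ('n, 'k) derivation \<Rightarrow> ('n, 'k) derivation"
  by unfold_locales (simp_all add: derivation_eq_iff der_apply_ops algebra_simps)

global_interpretation W: lie_algebra
  "der_scale :: 'k::field \<Rightarrow> ('n::finite, 'k) derivation \<Rightarrow> ('n, 'k) derivation" der_bracket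
  by unfold_locales
    (simp_all add: derivation_eq_iff der_apply_ops der_apply_simps(1,2) der_apply_diff
      Const_simps algebra_simps)

definition polynomial_lie_algebra :: "('n::finite, 'k::field) derivation set \<Rightarrow> bool" where
  "polynomial_lie_algebra L \<longleftrightarrow> W.subalgebra L \<and> W_mod.subspace L"

text \<open>The rank is the maximal number of elements linearly independent over the polynomial
ring.\<close>

definition has_rank :: "('n::finite, 'k::field) derivation set \<Rightarrow> nat \<Rightarrow> bool" where
  "has_rank L r \<longleftrightarrow>
     (\<exists>B\<subseteq>L. finite B \<and> W_mod.independent B \<and> card B = r) \<and>
     (\<forall>B\<subseteq>L. finite B \<and> W_mod.independent B \<longrightarrow> card B \<le> r)"

end

theory Submission
  imports Defs
begin

text \<open>
The rank-one hypothesis says that all elements of \<open>L\<close> are proportional over the polynomial ring. Fix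
\<open>D \<in> L\<close> and a polynomial \<open>p\<close> with \<open>D p \<noteq> 0\<close>. Over the fraction field \<open>Q\<close> of the polynomial ring every
\<open>x \<in> L\<close> is then the multiple \<open>\<phi> x = x p / D p\<close> of \<open>D\<close>, and \<open>\<phi>\<close> embeds \<open>F\<close> into \<open>Q\<close> in such a way that the
bracket becomes the Wronskian \<open>r \<delta> s - s \<delta> r\<close>, where \<open>\<delta>\<close> is the extension of \<open>D\<close> to \<open>Q\<close>
(\<open>line_algebra_of_derivations\<close>). So \<open>F\<close> is a finite-dimensional Lie algebra of vector fields on a
``line'', and the rest of the argument takes place in an arbitrary field with a derivation (locale
\<open>line_algebra\<close>). Replacing \<open>\<phi>\<close> by \<open>\<phi> / \<phi> b\<close> and \<open>\<delta>\<close> by \<open>\<phi> b \<cdot> \<delta>\<close> preserves the situation, so that any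
chosen \<open>b \<noteq> 0\<close> in \<open>F\<close> may be assumed to correspond to the function \<open>1\<close>; then \<open>ad b\<close> is just \<open>\<delta>\<close>.

If \<open>F\<close> is not abelian, some \<open>b \<in> F\<close> has an eigenvector \<open>e\<close> with \<open>[b, e] = e\<close> (\<open>ex_ad_fixed_vector\<close>).
Nonzero eigenvectors \<open>x\<close>, \<open>y\<close> of \<open>ad b\<close> with eigenvalues \<open>l\<close>, \<open>m\<close> have a bracket that corresponds to the
function \<open>(m - l) \<phi> x \<phi> y\<close>, so it vanishes only if \<open>l = m\<close>. If \<open>l \<noteq> 0\<close>, the members of the chain \<open>y\<close>,
\<open>[x, y]\<close>, \<open>[x, [x, y]]\<close>, ... have different eigenvalues \<open>m + k l\<close>, so the chain must end, which it can do only
by reaching \<open>l\<close>. This leaves no eigenvalues but \<open>1, 0, -1\<close> (\<open>eigenvalue_cases\<close>). A Jordan block for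
\<open>l \<noteq> 0\<close> would create an element of eigenvalue \<open>2 l\<close>, and one for \<open>0\<close> would create one for \<open>1\<close>, so there
are none (\<open>ad_semisimple\<close>). So \<open>F\<close> is the sum of three eigenspaces. That of \<open>0\<close> is
spanned by \<open>b\<close> (\<open>eigenspace_0\<close>). If \<open>-1\<close> does not occur, \<open>F\<close> is the semidirect product of the abelian
eigenspace of \<open>1\<close> with \<open>\<langle>b\<rangle>\<close>; if it does, both outer eigenspaces are lines, and \<open>F\<close> is \<open>sl\<^sub>2\<close>.
\<close>

section \<open>Linear operators on finite-dimensional spaces\<close>

text \<open>Every sequence in a finite-dimensional space becomes dependent. This one fact gives both the
annihilating polynomial of a vector and the finiteness of the set of eigenvalues.\<close>

lemma (in vector_space) no_infinite_independent_sequence: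
  assumes "finite B" and "range v \<subseteq> span B"
  shows "\<exists>n::nat. v n \<in> span (v ` {..<n})"
proof (rule ccontr)
  assume "\<not> ?thesis"
  then have new: "v n \<notin> span (v ` {..<n})" for n
    by blast
  have ind: "independent (v ` {..<n}) \<and> inj_on v {..<n}" for n
  proof (induction n)
    case (Suc n)
    then show ?case
      using independent_insertI[OF new, of n] new[of n] span_base[of "v n" "v ` {..<n}"]
      unfolding lessThan_Suc by (metis image_insert inj_on_insert Diff_subset image_mono subset_iff)
  qed (simp add: independent_empty)
  have "card (v ` {..<Suc (card B)}) \<le> card B"
    using independent_span_bound[OF assms(1)] ind assms(2) by (meson image_mono subset_UNIV order_trans)
  then show False
    using ind by (metis card_image card_lessThan not_less_eq_eq order_refl)
qed

locale finite_dim_operator = vector_space scale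
  for scale :: "'k::alg_closed_field \<Rightarrow> 'v::ab_group_add \<Rightarrow> 'v" +
  fixes T :: "'v \<Rightarrow> 'v" and S :: "'v set"
  assumes T_add: "T (x + y) = T x + T y"
    and T_scale: "T (scale c x) = scale c (T x)"
    and subspace_S: "subspace S"
    and finite_dim_S: "\<exists>B. finite B \<and> S \<subseteq> span B"
    and T_in: "x \<in> S \<Longrightarrow> T x \<in> S"
begin

text \<open>The value of the operator \<open>p(T)\<close> at a vector, by Horner's scheme in analogy with \<^const>\<open>poly\<close>.\<close>

definition act :: "'k poly \<Rightarrow> 'v \<Rightarrow> 'v" where
  "act p = fold_coeffs (\<lambda>a f v. scale a v + T (f v)) p (\<lambda>_. 0)"

lemma T_0: "T 0 = 0"
  using T_scale[of 0 0] by simp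

lemma act_0: "act 0 v = 0"
  by (simp add: act_def)

lemma act_pCons: "act (pCons a p) v = scale a v + T (act p v)"
  by (cases "p = 0 \<and> a = 0") (auto simp: act_def T_0)

lemma act_add: "act (p + q) v = act p v + act q v"
  by (induction p q rule: poly_induct2) (simp_all add: act_0 act_pCons T_add algebra_simps)

lemma act_smult: "act (smult c p) v = scale c (act p v)"
  by (induction p) (simp_all add: act_0 act_pCons T_scale algebra_simps)

lemma act_diff: "act (p - q) v = act p v - act q v"
  using act_add[of "p - q" q v] by simp

lemma act_mult: "act (p * q) v = act p (act q v)"
  by (induction p) (simp_all add: act_0 act_pCons act_add act_smult)

lemma act_monom: "act (monom 1 k) v = (T ^^ k) v"
  by (induction k) (simp_all add: act_pCons act_0 T_0 monom_Suc monom_0)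

lemma act_linear: "act p (v + w) = act p v + act p w" "act p (scale c v) = scale c (act p v)"
  by (induction p) (simp_all add: act_0 act_pCons T_add T_scale algebra_simps)

lemma act_eigenvector: "T x = scale l x \<Longrightarrow> act p x = scale (poly p l) x"
  by (induction p) (simp_all add: act_0 act_pCons T_scale algebra_simps)

lemma subspace_act_kernel: "subspace {v. act p v = 0}"
  using act_linear(2)[of p 0 0] by (auto simp: subspace_def act_linear)

lemma ex_annihilating_poly:
  assumes "v \<in> S"
  shows "\<exists>p. p \<noteq> 0 \<and> act p v = 0"
proof -
  have "(T ^^ k) v \<in> S" for k
    using assms by (induction k) (auto intro: T_in)
  then obtain n where n: "(T ^^ n) v \<in> span ((\<lambda>k. (T ^^ k) v) ` {..<n})"
    using finite_dim_S no_infinite_independent_sequence[of _ "\<lambda>k. (T ^^ k) v"] by blast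
  have "subspace {act p v |p. \<forall>k\<ge>n. coeff p k = 0}"
  proof (rule subspaceI)
    show "0 \<in> {act p v |p. \<forall>k\<ge>n. coeff p k = 0}"
      by (force intro: exI[of _ 0] simp: act_0)
  next
    fix x y
    assume "x \<in> {act p v |p. \<forall>k\<ge>n. coeff p k = 0}" "y \<in> {act p v |p. \<forall>k\<ge>n. coeff p k = 0}"
    then obtain p q where "x = act p v" "y = act q v"
      "\<forall>k\<ge>n. coeff p k = 0" "\<forall>k\<ge>n. coeff q k = 0" by blast
    then show "x + y \<in> {act p v |p. \<forall>k\<ge>n. coeff p k = 0}"
      by (intro CollectI exI[of _ "p + q"]) (simp add: act_add)
  next
    fix x c
    assume "x \<in> {act p v |p. \<forall>k\<ge>n. coeff p k = 0}"
    then obtain p where "x = act p v" "\<forall>k\<ge>n. coeff p k = 0" by blast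
    then show "scale c x \<in> {act p v |p. \<forall>k\<ge>n. coeff p k = 0}"
      by (intro CollectI exI[of _ "smult c p"]) (simp add: act_smult)
  qed
  moreover have "(\<lambda>k. (T ^^ k) v) ` {..<n} \<subseteq> {act p v |p. \<forall>k\<ge>n. coeff p k = 0}"
  proof
    fix x
    assume "x \<in> (\<lambda>k. (T ^^ k) v) ` {..<n}"
    then obtain i where "i < n" "x = (T ^^ i) v" by blast
    then show "x \<in> {act p v |p. \<forall>k\<ge>n. coeff p k = 0}"
      by (intro CollectI exI[of _ "monom 1 i"]) (simp add: act_monom)
  qed
  ultimately obtain p where p: "(T ^^ n) v = act p v" "\<forall>k\<ge>n. coeff p k = 0"
    using n span_minimal by blast
  have "coeff (monom 1 n - p) n = 1"
    using p(2) by simp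
  then have "monom 1 n - p \<noteq> 0"
    by (metis coeff_0 zero_neq_one)
  moreover have "act (monom 1 n - p) v = 0"
    using p(1) by (simp add: act_diff act_monom)
  ultimately show ?thesis by blast
qed

text \<open>Over an algebraically closed field each vector is killed by a product of operators \<open>T - l\<close>, so a set
that contains \<open>0\<close> and is closed under solving \<open>T w - l w \<in> Z\<close> for \<open>w\<close> contains the whole space. This
induction principle replaces the primary decomposition: existence of eigenvectors and
diagonalizability both follow by choosing \<open>Z\<close>.\<close>

theorem triangular_induct [consumes 1, case_names zero step]:
  assumes "v \<in> S"
    and zero: "0 \<in> Z"
    and step: "\<And>l w. w \<in> S \<Longrightarrow> T w - scale l w \<in> Z \<Longrightarrow> w \<in> Z"
  shows "v \<in> Z"
proof -
  have "v \<in> Z" if "p \<noteq> 0" "v \<in> S" "act p v = 0" for p v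
    using that
  proof (induction "degree p" arbitrary: p v rule: less_induct)
    case less
    show ?case
    proof (cases "degree p = 0")
      case True
      then obtain c where "p = [:c:]" by (rule degree_eq_zeroE)
      then show ?thesis
        using less.prems zero by (simp add: act_pCons act_0 T_0)
    next
      case False
      then obtain l where "poly p l = 0"
        using alg_closed_imp_poly_has_root by blast
      then obtain q where q: "p = [:- l, 1:] * q"
        by (metis dvdE poly_eq_0_iff_dvd)
      then have "q \<noteq> 0"
        using less.prems(1) by auto
      then have "degree p = degree [:- l, 1:] + degree q"
        unfolding q by (intro degree_mult_eq) auto
      then have "degree q < degree p"
        by simp
      \<comment> \<open>\<open>T - l\<close> is applied first, so that \<open>q\<close> annihilates \<open>T v - l v\<close>\<close>
      moreover have "act q (T v - scale l v) = act p v"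
        unfolding q mult.commute[of _ q] act_mult by (simp add: act_pCons act_0 T_0 act_linear)
      moreover have "T v - scale l v \<in> S"
        using less.prems(2) T_in subspace_S by (simp add: subspace_diff subspace_scale)
      ultimately have "T v - scale l v \<in> Z"
        using less \<open>q \<noteq> 0\<close> by simp
      then show ?thesis
        using step less.prems(2) by blast
    qed
  qed
  then show ?thesis
    using ex_annihilating_poly assms(1) by blast
qed

corollary ex_eigenvector:
  assumes "v \<in> S" "v \<noteq> 0"
  shows "\<exists>x l. x \<in> S \<and> x \<noteq> 0 \<and> T x = scale l x"
proof (rule ccontr)
  assume none: "\<not> ?thesis"
  \<comment> \<open>without eigenvectors every \<open>T - l\<close> is injective on \<open>S\<close>, so \<open>{0}\<close> has the closure property\<close>
  from assms(1) have "v \<in> {0}"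
    by (induction rule: triangular_induct) (use none in auto)
  then show False
    using assms(2) by simp
qed

lemma no_infinite_eigenvalue_sequence:
  assumes "inj l"
  shows "\<not> (\<forall>n::nat. \<exists>x\<in>S. x \<noteq> 0 \<and> T x = scale (l n) x)"
proof
  assume "\<forall>n. \<exists>x\<in>S. x \<noteq> 0 \<and> T x = scale (l n) x"
  then obtain x where x: "x n \<in> S" "x n \<noteq> 0" "T (x n) = scale (l n) (x n)" for n
    by metis
  then obtain n where n: "x n \<in> span (x ` {..<n})"
    using finite_dim_S no_infinite_independent_sequence[of _ x] by blast
  \<comment> \<open>This polynomial kills the first \<open>n\<close> eigenvectors but not the next one.\<close>
  define p where "p = (\<Prod>i<n. [:- l i, 1:])"
  have act_p: "act p (x m) = scale (\<Prod>i<n. l m - l i) (x m)" for m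
    using act_eigenvector[OF x(3)] by (simp add: p_def poly_prod)
  have "x ` {..<n} \<subseteq> {v. act p v = 0}"
    by (auto simp: act_p prod_zero_iff)
  then have "act p (x n) = 0"
    using n span_minimal[OF _ subspace_act_kernel] by blast
  then show False
    using x(2)[of n] assms by (auto simp: act_p prod_zero_iff inj_eq)
qed

end

section \<open>Three-dimensional simple Lie algebras\<close>

lemma lie_isomorphic_sym:
  assumes "lie_isomorphic sc1 br1 S sc2 br2 T"
    and "\<And>x y. x \<in> S \<Longrightarrow> y \<in> S \<Longrightarrow> x + y \<in> S" "\<And>c x. x \<in> S \<Longrightarrow> sc1 c x \<in> S"
    and "\<And>x y. x \<in> S \<Longrightarrow> y \<in> S \<Longrightarrow> br1 x y \<in> S"
  shows "lie_isomorphic sc2 br2 T sc1 br1 S"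
proof -
  from assms(1) obtain g where g: "bij_betw g S T"
    "\<And>x y. x \<in> S \<Longrightarrow> y \<in> S \<Longrightarrow> g (x + y) = g x + g y"
    "\<And>c x. x \<in> S \<Longrightarrow> g (sc1 c x) = sc2 c (g x)"
    "\<And>x y. x \<in> S \<Longrightarrow> y \<in> S \<Longrightarrow> g (br1 x y) = br2 (g x) (g y)"
    unfolding lie_isomorphic_def by blast
  define h where "h = inv_into S g"
  have h: "bij_betw h T S" "\<And>x. x \<in> S \<Longrightarrow> h (g x) = x"
    using g(1) by (auto simp: h_def bij_betw_inv_into bij_betw_inv_into_left)
  have T: "\<exists>x\<in>S. u = g x" if "u \<in> T" for u
    using g(1) that by (auto simp: bij_betw_def)
  have "h (u + v) = h u + h v" "h (br2 u v) = br1 (h u) (h v)" if "u \<in> T" "v \<in> T" for u v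
    using T[OF that(1)] T[OF that(2)] assms(2,4) g(2,4) h(2) by metis+
  moreover have "h (sc2 c u) = sc1 c (h u)" if "u \<in> T" for c u
    using T[OF that] assms(3) g(3) h(2) by metis
  ultimately show ?thesis
    unfolding lie_isomorphic_def using h(1) by blast
qed

context lie_algebra
begin

lemma bracket_0: "bracket 0 x = 0" "bracket x 0 = 0"
  using bracket_scale_left[of 0 0 x] bracket_scale_right[of x 0 0] by simp_all

lemma bracket_swap: "bracket y x = - bracket x y"
proof -
  have "bracket (x + y) (x + y) = bracket y x + bracket x y"
    unfolding bracket_add_left bracket_add_right by (simp add: bracket_self add.commute)
  then show ?thesis
    using bracket_self[of "x + y"] by (metis eq_neg_iff_add_eq_0)
qed

lemma bracket_diff:
  "bracket (x - y) z = bracket x z - bracket y z" "bracket x (y - z) = bracket x y - bracket x z"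
  using bracket_add_left[of "x - y" y z] bracket_add_right[of x "y - z" z] by simp_all

end

text \<open>A standard triple generates a copy of \<open>sl\<^sub>2\<close> whatever the Lie algebra around it. All claims are
computations in the coordinates \<open>a h + x e + y f\<close>.\<close>

locale sl2_triple = lie_algebra scale bracket
  for scale :: "'k::field \<Rightarrow> 'v::ab_group_add \<Rightarrow> 'v" and bracket +
  fixes h e f :: 'v
  assumes char_not_2: "(2::'k) \<noteq> 0"
    and e_nonzero: "e \<noteq> 0"
    and bracket_he: "bracket h e = scale 2 e"
    and bracket_hf: "bracket h f = scale (- 2) f"
    and bracket_ef: "bracket e f = h"
begin

definition comb :: "'k \<Rightarrow> 'k \<Rightarrow> 'k \<Rightarrow> 'v" where
  "comb a x y = scale a h + scale x e + scale y f"

lemma h_nonzero: "h \<noteq> 0"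
  using bracket_he e_nonzero char_not_2 by (auto simp: bracket_0)

lemma f_nonzero: "f \<noteq> 0"
  using bracket_ef h_nonzero by (auto simp: bracket_0)

lemma comb_add: "comb a x y + comb a' x' y' = comb (a + a') (x + x') (y + y')"
  by (simp add: comb_def scale_left_distrib add_ac)

lemma comb_scale: "scale c (comb a x y) = comb (c * a) (c * x) (c * y)"
  by (simp add: comb_def scale_right_distrib)

lemma comb_diff: "comb a x y - comb a' x' y' = comb (a - a') (x - x') (y - y')"
  by (simp add: comb_def scale_left_diff_distrib algebra_simps)

lemma comb_basis: "comb 1 0 0 = h" "comb 0 1 0 = e" "comb 0 0 1 = f" "comb 0 0 0 = 0"
  by (simp_all add: comb_def)

lemma span_eq: "span {h, e, f} = {comb a x y |a x y. True}"
proof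
  have "subspace {comb a x y |a x y. True}"
    by (rule subspaceI; clarsimp simp: comb_add comb_scale; metis comb_basis(4))
  then show "span {h, e, f} \<subseteq> {comb a x y |a x y. True}"
    by (intro span_minimal; clarsimp) (metis comb_basis)
  show "{comb a x y |a x y. True} \<subseteq> span {h, e, f}"
    by (auto simp: comb_def intro!: span_add span_scale intro: span_base)
qed

lemma bracket_comb:
  "bracket (comb a x y) (comb a' x' y') =
     comb (x * y' - y * x') (2 * (a * x' - x * a')) (2 * (y * a' - a * y'))"
proof -
  have "bracket e h = scale (- 2) e" "bracket f h = scale 2 f" "bracket f e = - h"
    using bracket_swap[of e h] bracket_swap[of f h] bracket_swap[of f e]
    by (simp_all add: bracket_he bracket_hf bracket_ef)
  then show ?thesis
    by (simp add: comb_def bracket_add_left bracket_add_right bracket_scale_left bracket_scale_right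
        bracket_self bracket_he bracket_hf bracket_ef scale_right_distrib scale_left_distrib
        scale_right_diff_distrib scale_left_diff_distrib algebra_simps)
qed

lemma bracket_h_comb: "bracket h (comb a x y) = comb 0 (2 * x) (2 * - y)"
  using bracket_comb[of 1 0 0 a x y] by (simp add: comb_basis)

text \<open>An ideal is stable under \<open>ad h\<close>, whose eigenvalues \<open>0\<close>, \<open>2\<close>, \<open>-2\<close> are distinct, so it contains the
components of its elements: applying \<open>ad h\<close> once and twice to \<open>a h + x e + y f\<close> gives \<open>2 x e - 2 y f\<close>
and \<open>4 x e + 4 y f\<close>. For the zero ideal this yields the uniqueness of coordinates.\<close>

lemma ideal_contains_components:
  assumes I: "lie_ideal I (span {h, e, f})" and v: "comb a x y \<in> I"
  shows "scale a h \<in> I" "scale x e \<in> I" "scale y f \<in> I"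
proof -
  have sub: "subspace I" and ad_h: "\<And>v. v \<in> I \<Longrightarrow> bracket h v \<in> I"
    using I span_base[of h "{h, e, f}"] by (auto simp: lie_ideal_def)
  have 1: "comb 0 (2 * x) (2 * - y) \<in> I"
    using ad_h[OF v] by (simp only: bracket_h_comb)
  have 2: "comb 0 (2 * (2 * x)) (2 * (2 * y)) \<in> I"
    using ad_h[OF 1] by (simp add: bracket_h_comb)
  have "(8::'k) = 2 * (2 * 2)" by simp
  then have eight: "(8::'k) \<noteq> 0"
    using char_not_2 by (metis no_zero_divisors)
  have "scale x e = scale (inverse 8) (comb 0 (2 * (2 * x)) (2 * (2 * y)) + scale 2 (comb 0 (2 * x) (2 * - y)))"
    by (simp add: comb_add comb_scale) (simp add: comb_def eight)
  then show x: "scale x e \<in> I"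
    using 1 2 sub by (simp add: subspace_add subspace_scale)
  have "scale y f = scale (inverse 8) (comb 0 (2 * (2 * x)) (2 * (2 * y)) - scale 2 (comb 0 (2 * x) (2 * - y)))"
    by (simp add: comb_diff comb_scale) (simp add: comb_def eight)
  then show y: "scale y f \<in> I"
    using 1 2 sub by (simp add: subspace_diff subspace_scale)
  have "scale a h = comb a x y - scale x e - scale y f"
    by (simp add: comb_def)
  then show "scale a h \<in> I"
    using x y v sub by (simp add: subspace_diff)
qed

lemma comb_eq_iff: "comb a x y = comb a' x' y' \<longleftrightarrow> a = a' \<and> x = x' \<and> y = y'"
proof
  assume "comb a x y = comb a' x' y'"
  then have "comb (a - a') (x - x') (y - y') \<in> {0}"
    by (simp flip: comb_diff)
  moreover have "lie_ideal {0} (span {h, e, f})"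
    by (simp add: lie_ideal_def span_zero bracket_0)
  ultimately show "a = a' \<and> x = x' \<and> y = y'"
    using ideal_contains_components h_nonzero e_nonzero f_nonzero by fastforce
qed simp

lemma dim_eq_3: "dim (span {h, e, f}) = 3"
proof -
  have "distinct [h, e, f]"
    using comb_eq_iff[of 1 0 0 0 1 0] comb_eq_iff[of 1 0 0 0 0 1] comb_eq_iff[of 0 1 0 0 0 1]
    by (simp add: comb_basis)
  moreover have "independent {h, e, f}"
  proof
    assume "dependent {h, e, f}"
    then obtain c where c: "\<exists>v\<in>{h, e, f}. c v \<noteq> 0" "(\<Sum>v\<in>{h, e, f}. scale (c v) v) = 0"
      using dependent_finite[of "{h, e, f}"] by auto
    have "comb (c h) (c e) (c f) = comb 0 0 0"
      using c(2) \<open>distinct [h, e, f]\<close> by (simp add: comb_def add.assoc)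
    then show False
      using c(1) by (auto simp: comb_eq_iff)
  qed
  ultimately show ?thesis
    by (simp add: dim_span_eq_card_independent dim_eq_card_independent)
qed

lemma subalgebra_span: "subalgebra (span {h, e, f})"
  unfolding subalgebra_def using subspace_span[of "{h, e, f}"]
  by (auto simp: span_eq) (metis bracket_comb)

text \<open>A nonzero ideal contains one of \<open>h\<close>, \<open>e\<close>, \<open>f\<close> by the previous lemmas, hence \<open>h = [e, f]\<close>, hence all three.\<close>

lemma simple_span: "simple (span {h, e, f})"
  unfolding simple_def
proof (intro conjI allI impI)
  have mem: "h \<in> span {h, e, f}" "e \<in> span {h, e, f}" "f \<in> span {h, e, f}"
    by (auto intro: span_base)
  then show "\<not> abelian (span {h, e, f})"
    using bracket_ef h_nonzero by (auto simp: abelian_def)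
  show "subalgebra (span {h, e, f})"
    by (rule subalgebra_span)
  fix I
  assume I: "lie_ideal I (span {h, e, f})"
  then have sub: "subspace I" "I \<subseteq> span {h, e, f}"
    and ad: "\<And>x v. x \<in> span {h, e, f} \<Longrightarrow> v \<in> I \<Longrightarrow> bracket x v \<in> I"
    by (auto simp: lie_ideal_def)
  have cancel: "v \<in> I" if "scale c v \<in> I" "c \<noteq> 0" for c v
    using subspace_scale[OF sub(1) that(1), of "inverse c"] that(2) by simp
  have h_full: "span {h, e, f} \<subseteq> I" if "h \<in> I"
  proof -
    have "scale (- 2) e \<in> I" "scale 2 f \<in> I"
      using ad[OF mem(2) that] ad[OF mem(3) that] bracket_swap[of e h] bracket_swap[of f h]
      by (simp_all add: bracket_he bracket_hf)
    then have "e \<in> I" "f \<in> I"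
      using cancel char_not_2 by (metis neg_equal_0_iff_equal)+
    then show ?thesis
      using that by (intro span_minimal sub(1)) simp
  qed
  show "I = {0} \<or> I = span {h, e, f}"
  proof (cases "I = {0}")
    case False
    then obtain v where v: "v \<in> I" "v \<noteq> 0"
      using subspace_0[OF sub(1)] by blast
    then obtain a x y where axy: "v = comb a x y"
      using sub(2) by (auto simp: span_eq)
    then have "a \<noteq> 0 \<or> x \<noteq> 0 \<or> y \<noteq> 0"
      using v(2) comb_basis(4) by metis
    then have "h \<in> I \<or> e \<in> I \<or> f \<in> I"
      using ideal_contains_components[OF I] v(1) cancel unfolding axy by metis
    moreover have "h \<in> I" if "e \<in> I"
      using ad[OF mem(3) that] bracket_swap[of f e] subspace_neg[OF sub(1)]
      by (fastforce simp: bracket_ef)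
    moreover have "h \<in> I" if "f \<in> I"
      using ad[OF mem(2) that] by (simp add: bracket_ef)
    ultimately show ?thesis
      using h_full sub(2) by blast
  qed simp
qed

lemma isomorphic_sl2:
  "lie_isomorphic scale bracket (span {h, e, f}) mat_scale mat_bracket (sl2 :: ('k^2^2) set)"
proof (rule lie_isomorphic_sym)
  \<comment> \<open>\<open>h\<close>, \<open>e\<close>, \<open>f\<close> correspond to the usual matrices, and the entry \<open>(2, 2)\<close> is minus the entry \<open>(1, 1)\<close>\<close>
  define g where "g M = comb (M$1$1) (M$1$2) (M$2$1)" for M :: "'k^2^2"
  have sl2_iff: "M \<in> sl2 \<longleftrightarrow> M$2$2 = - M$1$1" for M :: "'k^2^2"
    by (auto simp: sl2_def trace_def sum_2 eq_neg_iff_add_eq_0 add.commute)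
  have "inj_on g sl2"
    by (auto simp: inj_on_def g_def comb_eq_iff sl2_iff vec_eq_iff forall_2)
  moreover have "comb a x y \<in> g ` sl2" for a x y
    by (rule image_eqI[of _ _ "vector [vector [a, x], vector [y, - a]]"])
      (simp_all add: g_def sl2_iff)
  then have "g ` sl2 = span {h, e, f}"
    by (auto simp: span_eq g_def)
  ultimately have "bij_betw g sl2 (span {h, e, f})"
    by (simp add: bij_betw_def)
  moreover have "g (M + N) = g M + g N" "g (mat_scale c M) = scale c (g M)" for c M N
    by (simp_all add: g_def comb_add comb_scale mat_scale_def)
  moreover have "g (mat_bracket M N) = bracket (g M) (g N)" if "M \<in> sl2" "N \<in> sl2" for M N
    using that
    by (simp add: g_def bracket_comb sl2_iff comb_eq_iff mat_bracket_def matrix_matrix_mult_def sum_2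
        algebra_simps)
  ultimately show "lie_isomorphic mat_scale mat_bracket sl2 scale bracket (span {h, e, f})"
    unfolding lie_isomorphic_def by blast
  show "M + N \<in> sl2" "mat_scale c M \<in> sl2" "mat_bracket M N \<in> sl2"
    if "M \<in> sl2" "N \<in> sl2" for M N :: "'k^2^2" and c
    using that
    by (simp_all add: sl2_iff mat_scale_def mat_bracket_def matrix_matrix_mult_def sum_2)
qed

end

section \<open>Finite-dimensional Lie algebras of vector fields on a line\<close>

text \<open>Here \<open>F\<close> consists of multiples \<open>\<phi> x \<cdot> \<delta>\<close> of a single derivation \<open>\<delta>\<close> of a field, whose constants contain
the ground field by means of \<open>\<kappa>\<close>. The last assumption is the Leibniz formula for the commutator of two
such multiples.\<close>

locale line_algebra = lie_algebra scale bracket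
  for scale :: "'k::{alg_closed_field, field_char_0} \<Rightarrow> 'v::ab_group_add \<Rightarrow> 'v" and bracket +
  fixes F :: "'v set" and \<kappa> :: "'k \<Rightarrow> 'q::field" and \<delta> :: "'q \<Rightarrow> 'q" and \<phi> :: "'v \<Rightarrow> 'q"
  assumes subalgebra_F: "subalgebra F"
    and finite_dim_F: "finite_dim F"
    and kappa_add: "\<kappa> (a + b) = \<kappa> a + \<kappa> b"
    and kappa_mult: "\<kappa> (a * b) = \<kappa> a * \<kappa> b"
    and kappa_1: "\<kappa> 1 = 1"
    and delta_add: "\<delta> (p + q) = \<delta> p + \<delta> q"
    and delta_mult: "\<delta> (p * q) = \<delta> p * q + p * \<delta> q"
    and delta_kappa: "\<delta> (\<kappa> c) = 0"
    and phi_add: "\<phi> (x + y) = \<phi> x + \<phi> y"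
    and phi_scale: "\<phi> (scale c x) = \<kappa> c * \<phi> x"
    and phi_eq_0: "x \<in> F \<Longrightarrow> \<phi> x = 0 \<Longrightarrow> x = 0"
    and phi_bracket: "x \<in> F \<Longrightarrow> y \<in> F \<Longrightarrow> \<phi> (bracket x y) = \<phi> x * \<delta> (\<phi> y) - \<phi> y * \<delta> (\<phi> x)"
begin

lemma subspace_F: "subspace F"
  and bracket_in: "x \<in> F \<Longrightarrow> y \<in> F \<Longrightarrow> bracket x y \<in> F"
  using subalgebra_F by (auto simp: subalgebra_def)

lemmas F_closed = bracket_in subspace_add[OF subspace_F] subspace_diff[OF subspace_F]
  subspace_scale[OF subspace_F] subspace_neg[OF subspace_F] subspace_0[OF subspace_F]

lemma kappa_0: "\<kappa> 0 = 0"
  by (metis kappa_add add_0 add_cancel_right_right)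

lemma kappa_minus: "\<kappa> (- a) = - \<kappa> a"
  using kappa_add[of "- a" a] by (simp add: kappa_0 eq_neg_iff_add_eq_0)

lemma kappa_diff: "\<kappa> (a - b) = \<kappa> a - \<kappa> b"
  using kappa_add[of a "- b"] by (simp add: kappa_minus)

lemma kappa_eq_0_iff: "\<kappa> a = 0 \<longleftrightarrow> a = 0"
  by (metis kappa_0 kappa_1 kappa_mult mult_zero_left right_inverse zero_neq_one)

lemma delta_0: "\<delta> 0 = 0"
  by (metis delta_add add_0 add_cancel_right_right)

lemma delta_1: "\<delta> 1 = 0"
  using delta_kappa[of 1] by (simp add: kappa_1)

lemma delta_diff: "\<delta> (p - q) = \<delta> p - \<delta> q"
  using delta_add[of "p - q" q] by simp

lemma delta_divide:
  assumes "q \<noteq> 0"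
  shows "\<delta> (p / q) = (\<delta> p * q - p * \<delta> q) / q\<^sup>2"
proof -
  have "\<delta> p = \<delta> (p / q) * q + p / q * \<delta> q"
    using delta_mult[of "p / q" q] assms by simp
  then show ?thesis
    using assms by (simp add: field_simps power2_eq_square)
qed

lemma phi_0: "\<phi> 0 = 0"
  by (metis phi_add add_0 add_cancel_right_right)

lemma phi_diff: "\<phi> (x - y) = \<phi> x - \<phi> y"
  using phi_add[of "x - y" y] by simp

lemma phi_eq_iff: "x \<in> F \<Longrightarrow> y \<in> F \<Longrightarrow> \<phi> x = \<phi> y \<longleftrightarrow> x = y"
  using phi_eq_0[of "x - y"] by (auto simp: phi_diff F_closed)

lemma finite_dim_operatorI:
  assumes "subspace S" "S \<subseteq> F" "\<And>x. x \<in> S \<Longrightarrow> T x \<in> S"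
    and "\<And>x y. T (x + y) = T x + T y" "\<And>c x. T (scale c x) = scale c (T x)"
  shows "finite_dim_operator scale T S"
proof
  show "\<exists>B. finite B \<and> S \<subseteq> span B"
    using finite_dim_F assms(2) by (auto simp: finite_dim_def)
qed (use assms in auto)

text \<open>The derivation can be replaced by the member \<open>\<phi> b \<cdot> \<delta>\<close> of the algebra, and \<open>b\<close> then has the coefficient
\<open>1\<close>. The Wronskian is compatible with this change because the terms with \<open>\<delta> (\<phi> b)\<close> cancel.\<close>

lemma line_algebra_rebase:
  assumes "b \<in> F" "b \<noteq> 0"
  shows "line_algebra scale bracket F \<kappa> (\<lambda>q. \<phi> b * \<delta> q) (\<lambda>x. \<phi> x / \<phi> b)"
proof
  have b: "\<phi> b \<noteq> 0"
    using assms phi_eq_0 by blast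
  show "x = 0" if "x \<in> F" "\<phi> x / \<phi> b = 0" for x
    using that b phi_eq_0 by simp
  show "\<phi> (bracket x y) / \<phi> b =
      \<phi> x / \<phi> b * (\<phi> b * \<delta> (\<phi> y / \<phi> b)) - \<phi> y / \<phi> b * (\<phi> b * \<delta> (\<phi> x / \<phi> b))"
    if "x \<in> F" "y \<in> F" for x y
    using that b by (simp add: phi_bracket delta_divide field_simps power2_eq_square)
qed (simp_all add: subalgebra_F finite_dim_F kappa_add kappa_mult kappa_1 delta_add delta_mult
    delta_kappa phi_add phi_scale algebra_simps add_divide_distrib)

end

locale based_line_algebra = line_algebra scale bracket F \<kappa> \<delta> \<phi>
  for scale :: "'k::{alg_closed_field, field_char_0} \<Rightarrow> 'v::ab_group_add \<Rightarrow> 'v" and bracket F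
    and \<kappa> :: "'k \<Rightarrow> 'q::field" and \<delta> \<phi> +
  fixes b :: 'v
  assumes b_in: "b \<in> F" and phi_b: "\<phi> b = 1"
begin

definition eigenspace :: "'k \<Rightarrow> 'v set" where
  "eigenspace l = {x \<in> F. bracket b x = scale l x}"

lemma phi_ad: "x \<in> F \<Longrightarrow> \<phi> (bracket b x) = \<delta> (\<phi> x)"
  by (simp add: phi_bracket b_in phi_b delta_1)

lemma eigenspace_iff: "x \<in> eigenspace l \<longleftrightarrow> x \<in> F \<and> \<delta> (\<phi> x) = \<kappa> l * \<phi> x"
proof (cases "x \<in> F")
  case True
  then show ?thesis
    using phi_eq_iff[of "bracket b x" "scale l x"]
    by (auto simp: eigenspace_def phi_ad phi_scale F_closed b_in)
qed (simp add: eigenspace_def)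

lemma subspace_eigenspace: "subspace (eigenspace l)"
  by (auto simp: subspace_def eigenspace_iff F_closed phi_add phi_scale phi_0 delta_add delta_0
      delta_mult delta_kappa algebra_simps)

lemma finite_dim_operator_ad: "finite_dim_operator scale (bracket b) F"
  by (intro finite_dim_operatorI subspace_F)
    (auto simp: F_closed b_in bracket_add_right bracket_scale_right)

text \<open>For nonzero eigenvectors the Wronskian is a scalar multiple of a product in a field, so the bracket can
only vanish if the eigenvalues agree. The whole classification rests on this.\<close>

lemma bracket_eigenspace:
  assumes "x \<in> eigenspace l" "y \<in> eigenspace m"
  shows "bracket x y \<in> eigenspace (l + m)" "\<phi> (bracket x y) = \<kappa> (m - l) * (\<phi> x * \<phi> y)"
proof -
  show *: "\<phi> (bracket x y) = \<kappa> (m - l) * (\<phi> x * \<phi> y)"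
    using assms by (simp add: eigenspace_iff phi_bracket kappa_diff algebra_simps)
  show "bracket x y \<in> eigenspace (l + m)"
    using assms unfolding eigenspace_iff * by (simp add: F_closed delta_mult delta_kappa kappa_add algebra_simps)
qed

text \<open>If \<open>ad b\<close> has a nonzero eigenvalue, a multiple of \<open>b\<close> will do. Otherwise \<open>ad b\<close> is nilpotent and not
zero, so there is \<open>w\<close> with \<open>c = \<delta> (\<phi> w)\<close> a nonzero constant of \<open>\<delta>\<close>. In terms of functions, bracketing with
\<open>w\<close> multiplies the centralizer of \<open>b\<close> by \<open>c\<close>; it has an eigenvector there, and the eigenvalue is not
zero. Thus a multiple of \<open>w\<close> has the required property.\<close>

lemma ex_ad_fixed_vector:
  assumes y: "y \<in> F" "bracket b y \<noteq> 0"
  shows "\<exists>c x. c \<in> F \<and> x \<in> F \<and> x \<noteq> 0 \<and> bracket c x = x"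
proof (cases "\<exists>l x. l \<noteq> 0 \<and> x \<noteq> 0 \<and> x \<in> eigenspace l")
  case True
  then obtain l x where "l \<noteq> 0" "x \<noteq> 0" "x \<in> F" "bracket b x = scale l x"
    by (auto simp: eigenspace_def)
  then show ?thesis
    by (intro exI[of _ "scale (inverse l) b"] exI[of _ x])
      (simp add: bracket_scale_left F_closed b_in)
next
  case False
  interpret ad: finite_dim_operator scale "bracket b" F
    by (rule finite_dim_operator_ad)
  \<comment> \<open>otherwise the kernel of \<open>ad b\<close> is closed in the sense of the induction principle, and \<open>y\<close> lies in it\<close>
  have "\<exists>w\<in>F. bracket b w \<noteq> 0 \<and> bracket b (bracket b w) = 0"
  proof (rule ccontr)
    assume nilp: "\<not> ?thesis"
    from y(1) have "y \<in> {w \<in> F. bracket b w = 0}"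
    proof (induction rule: ad.triangular_induct)
      case zero
      then show ?case by (simp add: F_closed bracket_0)
    next
      case (step l w)
      then have "bracket b w \<in> eigenspace l"
        by (simp add: eigenspace_def F_closed b_in bracket_diff bracket_scale_right)
      then have "l = 0 \<or> bracket b w = 0"
        using False by blast
      then show ?case
        using step nilp by auto
    qed
    then show False
      using y(2) by simp
  qed
  then obtain w where w: "w \<in> F" "bracket b w \<noteq> 0" "bracket b (bracket b w) = 0"
    by blast
  define c where "c = \<delta> (\<phi> w)"
  have c: "c \<noteq> 0" "\<delta> c = 0"
    using w phi_ad[of w] phi_ad[of "bracket b w"] phi_eq_0[of "bracket b w"]
    by (auto simp: c_def F_closed b_in phi_0)
  have phi_w: "\<phi> (bracket x w) = c * \<phi> x" if "x \<in> eigenspace 0" for x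
    using that w(1) by (simp add: eigenspace_iff phi_bracket c_def kappa_0)
  interpret op: finite_dim_operator scale "\<lambda>x. bracket x w" "eigenspace 0"
  proof (intro finite_dim_operatorI subspace_eigenspace)
    show "bracket x w \<in> eigenspace 0" if "x \<in> eigenspace 0" for x
      using that w(1) phi_w[OF that]
      by (simp add: eigenspace_iff F_closed delta_mult c(2) kappa_0)
  qed (auto simp: eigenspace_def bracket_add_left bracket_scale_left)
  have "b \<in> eigenspace 0"
    by (simp add: eigenspace_def b_in bracket_self)
  moreover have "b \<noteq> 0"
    using phi_b phi_0 by auto
  ultimately obtain x l where x: "x \<in> eigenspace 0" "x \<noteq> 0" "bracket x w = scale l x"
    using op.ex_eigenvector by blast
  have "x \<in> F"
    using x(1) by (simp add: eigenspace_def)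
  have "c * \<phi> x \<noteq> 0"
    using c(1) x(2) phi_eq_0[OF \<open>x \<in> F\<close>] by auto
  then have "l \<noteq> 0"
    using phi_w[OF x(1)] by (auto simp: x(3) phi_0)
  then have "bracket (scale (- inverse l) w) x = x"
    using x(3) bracket_swap[of w x] \<open>l \<noteq> 0\<close> by (simp only: bracket_scale_left) simp
  then show ?thesis
    using x(2) \<open>x \<in> F\<close> w(1) F_closed(4) by blast
qed

text \<open>The vectors \<open>(ad x)\<^sup>k y\<close> have the pairwise distinct eigenvalues \<open>m + k l\<close>, so one of them vanishes. By the
product formula for the bracket this happens only after the eigenvalue \<open>l\<close> has been reached.\<close>

lemma eigenvalue_progression:
  assumes x: "x \<in> eigenspace l" "x \<noteq> 0" "l \<noteq> 0" and y: "y \<in> eigenspace m" "y \<noteq> 0"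
  shows "\<exists>k. m + of_nat k * l = l"
proof (rule ccontr)
  assume none: "\<nexists>k. m + of_nat k * l = l"
  interpret ad: finite_dim_operator scale "bracket b" F
    by (rule finite_dim_operator_ad)
  have *: "(bracket x ^^ k) y \<in> eigenspace (m + of_nat k * l) \<and> (bracket x ^^ k) y \<noteq> 0" for k
  proof (induction k)
    case (Suc k)
    define z where "z = (bracket x ^^ k) y"
    have z: "z \<in> eigenspace (m + of_nat k * l)" "z \<noteq> 0"
      using Suc by (simp_all add: z_def)
    have "\<phi> x \<noteq> 0" "\<phi> z \<noteq> 0"
      using x z phi_eq_0 by (auto simp: eigenspace_iff)
    moreover have "m + of_nat k * l - l \<noteq> 0"
      using none by simp
    ultimately have "\<phi> (bracket x z) \<noteq> 0"
      by (simp add: bracket_eigenspace(2)[OF x(1) z(1)] kappa_eq_0_iff)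
    then have "bracket x z \<noteq> 0"
      using phi_0 by auto
    moreover have "bracket x z \<in> eigenspace (m + of_nat (Suc k) * l)"
      using bracket_eigenspace(1)[OF x(1) z(1)] by (simp add: algebra_simps)
    ultimately show ?case
      by (simp add: z_def)
  qed (use y in simp)
  have "inj (\<lambda>k. m + of_nat k * l)"
    using x(3) by (auto simp: inj_def)
  then show False
    using ad.no_infinite_eigenvalue_sequence * by (auto simp: eigenspace_def)
qed

end

text \<open>The eigenvalue is normalized to \<open>1\<close>, which is possible for any nonzero eigenvalue of any \<open>ad b\<close> by
rescaling \<open>b\<close>.\<close>

locale split_line_algebra = based_line_algebra scale bracket F \<kappa> \<delta> \<phi> b
  for scale :: "'k::{alg_closed_field, field_char_0} \<Rightarrow> 'v::ab_group_add \<Rightarrow> 'v" and bracket F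
    and \<kappa> :: "'k \<Rightarrow> 'q::field" and \<delta> \<phi> b +
  fixes e :: 'v
  assumes e_in: "e \<in> eigenspace 1" and e_nonzero: "e \<noteq> 0"
begin

text \<open>By \<open>eigenvalue_progression\<close> for \<open>e\<close> and \<open>y\<close>, \<open>m = 1 - k\<close> for a natural number \<open>k\<close>; with the roles exchanged,
\<open>1 = (1 - j) m\<close>. So \<open>m\<close> is a unit of the integers, if it is not zero.\<close>

lemma eigenvalue_cases:
  assumes y: "y \<in> eigenspace m" "y \<noteq> 0"
  shows "m = 1 \<or> m = 0 \<or> m = - 1"
proof (cases "m = 0")
  case False
  obtain k where k: "m + of_nat k * 1 = 1"
    using eigenvalue_progression[OF e_in e_nonzero _ y] by auto
  obtain j where j: "1 + of_nat j * m = m"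
    using eigenvalue_progression[OF y False e_in e_nonzero] by auto
  have m: "m = of_int (1 - int k)"
    using k by (simp add: algebra_simps)
  have "of_int (1 + int j * (1 - int k)) = (of_int (1 - int k) :: 'k)"
    using j unfolding m by simp
  then have "1 + int j * (1 - int k) = 1 - int k"
    by (simp only: of_int_eq_iff)
  then have "(1 - int k) * (1 - int j) = 1"
    by (simp add: algebra_simps)
  then have "1 - int k = 1 \<or> 1 - int k = - 1"
    using zmult_eq_1_iff by blast
  then show ?thesis
    unfolding m by (metis of_int_1 of_int_minus)
qed simp

text \<open>Suppose that \<open>u = [b, v] - l v\<close> is a nonzero eigenvector. Then \<open>[u, v]\<close> corresponds to the function
\<open>(\<phi> u)\<^sup>2\<close>, which has eigenvalue \<open>2 l\<close>; for \<open>l = 1\<close> and \<open>l = -1\<close> this is impossible. For \<open>l = 0\<close>, the bracket \<open>[v, e]\<close>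
would produce a Jordan block for the eigenvalue \<open>1\<close>, which has just been excluded.\<close>

lemma ad_semisimple:
  assumes v: "v \<in> F" "bracket b v - scale l v \<in> eigenspace l"
  shows "v \<in> eigenspace l"
proof -
  have jordan_block: "\<delta> (\<phi> v) = \<kappa> l * \<phi> v + \<phi> u"
    if "v \<in> F" "u = bracket b v - scale l v" for u v l
    using that by (simp add: phi_diff phi_scale phi_ad)
  have nonzero: "v \<in> eigenspace l"
    if v: "v \<in> F" "bracket b v - scale l v \<in> eigenspace l" and "l \<noteq> 0" for v l
  proof (rule ccontr)
    define u where "u = bracket b v - scale l v"
    assume "v \<notin> eigenspace l"
    then have "u \<noteq> 0"
      using v by (auto simp: u_def eigenspace_def)
    have u: "u \<in> F" "\<delta> (\<phi> u) = \<kappa> l * \<phi> u"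
      using v(2) by (simp_all add: u_def eigenspace_iff)
    have "\<phi> (bracket u v) = (\<phi> u)\<^sup>2"
      using u v(1) jordan_block[OF v(1) u_def] by (simp add: phi_bracket algebra_simps power2_eq_square)
    moreover have "\<phi> u \<noteq> 0"
      using \<open>u \<noteq> 0\<close> u(1) phi_eq_0 by blast
    ultimately have "bracket u v \<noteq> 0" "bracket u v \<in> eigenspace (2 * l)"
      using u v(1) kappa_add[of l l]
      by (auto simp: eigenspace_iff F_closed delta_mult power2_eq_square algebra_simps phi_0)
    then have "2 * l = 1 \<or> 2 * l = 0 \<or> 2 * l = - 1"
      using eigenvalue_cases by blast
    moreover have "l = 1 \<or> l = 0 \<or> l = - 1"
      using eigenvalue_cases v(2) \<open>u \<noteq> 0\<close> by (auto simp: u_def)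
    ultimately show False
      using \<open>l \<noteq> 0\<close> by auto
  qed
  show ?thesis
  proof (cases "l = 0")
    case True
    define u where "u = bracket b v"
    have u: "u \<in> F" "\<delta> (\<phi> u) = 0" "\<delta> (\<phi> v) = \<phi> u"
      using v True jordan_block[OF v(1), of u 0] by (simp_all add: u_def eigenspace_iff kappa_0)
    have e: "e \<in> F" "\<delta> (\<phi> e) = \<phi> e"
      using e_in by (simp_all add: eigenspace_iff kappa_1)
    define z where "z = bracket v e"
    have z: "z \<in> F" "\<phi> z = \<phi> v * \<phi> e - \<phi> e * \<phi> u"
      using e u v(1) by (simp_all add: z_def F_closed phi_bracket)
    have "\<delta> (\<phi> z) = \<phi> z + \<phi> u * \<phi> e"
      unfolding z(2) by (simp add: delta_diff delta_mult e u algebra_simps)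
    then have phi_z': "\<phi> (bracket b z - scale 1 z) = \<phi> u * \<phi> e"
      using z(1) by (simp add: phi_diff phi_ad)
    then have "bracket b z - scale 1 z \<in> eigenspace 1"
      using z(1) by (simp add: eigenspace_iff F_closed b_in delta_mult e u kappa_1)
    then have "z \<in> eigenspace 1"
      using nonzero z(1) by simp
    then have "\<phi> u * \<phi> e = 0"
      using phi_z' by (simp add: eigenspace_def phi_0)
    then have "u = 0"
      using e(1) u(1) phi_eq_0 e_nonzero by auto
    then show ?thesis
      using True v(1) by (simp add: u_def eigenspace_def)
  qed (use nonzero v in blast)
qed

text \<open>Triangular induction: if \<open>(ad b - l) x\<close> is a sum of eigenvectors, then \<open>x\<close> differs from an explicit sum of
eigenvectors by a generalized eigenvector for \<open>l\<close>, which is an eigenvector by \<open>ad_semisimple\<close>.\<close>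

lemma eigenspace_decomposition:
  assumes "x \<in> F"
  obtains u v w where "x = u + v + w" "u \<in> eigenspace 1" "v \<in> eigenspace 0" "w \<in> eigenspace (- 1)"
proof -
  interpret ad: finite_dim_operator scale "bracket b" F
    by (rule finite_dim_operator_ad)
  let ?Z = "{u + v + w |u v w. u \<in> eigenspace 1 \<and> v \<in> eigenspace 0 \<and> w \<in> eigenspace (- 1)}"
  have eigenspace_sum: "y \<in> ?Z" if "y \<in> eigenspace m" for y m
  proof (cases "y = 0")
    case True
    then show ?thesis
      using subspace_0[OF subspace_eigenspace] by force
  next
    case False
    then have "m = 1 \<or> m = 0 \<or> m = - 1"
      using eigenvalue_cases that by blast
    then show ?thesis
      using that subspace_0[OF subspace_eigenspace] by (metis (mono_tags, lifting) CollectI add_0 add_0_right)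
  qed
  have sum_add: "y + z \<in> ?Z" if "y \<in> ?Z" "z \<in> ?Z" for y z
  proof -
    obtain u v w u' v' w' where "y = u + v + w" "z = u' + v' + w'"
      "u \<in> eigenspace 1" "v \<in> eigenspace 0" "w \<in> eigenspace (- 1)"
      "u' \<in> eigenspace 1" "v' \<in> eigenspace 0" "w' \<in> eigenspace (- 1)"
      using \<open>y \<in> ?Z\<close> \<open>z \<in> ?Z\<close> by blast
    then show ?thesis
      by (intro CollectI exI[of _ "u + u'"] exI[of _ "v + v'"] exI[of _ "w + w'"])
        (simp add: subspace_add[OF subspace_eigenspace] algebra_simps)
  qed
  \<comment> \<open>every eigenvector lies in the range of \<open>ad b - l\<close> or is an eigenvector for \<open>l\<close> itself\<close>
  have solve: "\<exists>y'. y' \<in> ?Z \<and> y' \<in> F \<and> y - (bracket b y' - scale l y') \<in> eigenspace l"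
    if "y \<in> eigenspace m" for y m l
  proof (cases "m = l")
    case True
    then show ?thesis
      using that eigenspace_sum[of 0 0] subspace_0[OF subspace_eigenspace]
      by (intro exI[of _ 0]) (simp add: bracket_0 F_closed)
  next
    case False
    have "scale (inverse (m - l)) y \<in> eigenspace m"
      using that subspace_eigenspace subspace_scale by blast
    moreover from this have "y - (bracket b (scale (inverse (m - l)) y) - scale l (scale (inverse (m - l)) y)) = 0"
      using False by (simp add: eigenspace_def flip: scale_left_diff_distrib right_diff_distrib)
        (simp flip: left_diff_distrib)
    ultimately show ?thesis
      using eigenspace_sum subspace_0[OF subspace_eigenspace] by (metis (no_types, lifting) eigenspace_def mem_Collect_eq)
  qed
  from assms have "x \<in> ?Z"
  proof (induction rule: ad.triangular_induct)
    case zero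
    show ?case
      using eigenspace_sum subspace_0[OF subspace_eigenspace] by blast
  next
    case (step l x)
    then obtain u v w where uvw: "bracket b x - scale l x = u + v + w"
      "u \<in> eigenspace 1" "v \<in> eigenspace 0" "w \<in> eigenspace (- 1)"
      by blast
    from solve[OF uvw(2), of l] solve[OF uvw(3), of l] solve[OF uvw(4), of l]
    obtain u' v' w' where u': "u' \<in> ?Z" "u' \<in> F" "u - (bracket b u' - scale l u') \<in> eigenspace l"
      and v': "v' \<in> ?Z" "v' \<in> F" "v - (bracket b v' - scale l v') \<in> eigenspace l"
      and w': "w' \<in> ?Z" "w' \<in> F" "w - (bracket b w' - scale l w') \<in> eigenspace l"
      by blast
    define y where "y = x - (u' + v' + w')"
    have "bracket b y - scale l y =
        (u - (bracket b u' - scale l u')) + (v - (bracket b v' - scale l v')) + (w - (bracket b w' - scale l w'))"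
      using uvw(1) by (simp add: y_def bracket_diff bracket_add_right scale_right_distrib scale_right_diff_distrib algebra_simps)
    then have "bracket b y - scale l y \<in> eigenspace l"
      using u'(3) v'(3) w'(3) subspace_add[OF subspace_eigenspace] by presburger
    moreover have "y \<in> F"
      using step(1) u'(2) v'(2) w'(2) by (simp add: y_def F_closed)
    ultimately have "y \<in> ?Z"
      using ad_semisimple eigenspace_sum by blast
    moreover have "x = y + (u' + v' + w')"
      by (simp add: y_def)
    ultimately show ?case
      using sum_add u'(1) v'(1) w'(1) by presburger
  qed
  then show ?thesis
    using that by blast
qed

text \<open>If \<open>[b, y] = 0\<close>, then \<open>ad y\<close> acts on the eigenspace of \<open>1\<close> as multiplication by the function \<open>\<phi> y\<close>.
An eigenvector there forces \<open>\<phi> y\<close> to be a scalar.\<close>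

lemma eigenspace_0: "eigenspace 0 = span {b}"
proof
  show "eigenspace 0 \<subseteq> span {b}"
  proof
    fix y
    assume y: "y \<in> eigenspace 0"
    have phi: "\<phi> (bracket y x) = \<phi> y * \<phi> x" if "x \<in> eigenspace 1" for x
      using bracket_eigenspace(2)[OF y that] by (simp add: kappa_1)
    interpret op: finite_dim_operator scale "bracket y" "eigenspace 1"
    proof (intro finite_dim_operatorI subspace_eigenspace)
      show "bracket y x \<in> eigenspace 1" if "x \<in> eigenspace 1" for x
        using bracket_eigenspace(1)[OF y that] by simp
    qed (auto simp: eigenspace_def bracket_add_right bracket_scale_right)
    obtain x l where x: "x \<in> eigenspace 1" "x \<noteq> 0" "bracket y x = scale l x"
      using op.ex_eigenvector[OF e_in e_nonzero] by blast
    then have "\<phi> y * \<phi> x = \<kappa> l * \<phi> x"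
      using phi[OF x(1)] by (metis phi_scale)
    moreover have "\<phi> x \<noteq> 0"
      using x(1,2) phi_eq_0 by (auto simp: eigenspace_iff)
    ultimately have "\<phi> y = \<phi> (scale l b)"
      by (auto simp: phi_scale phi_b)
    then have "y = scale l b"
      using y phi_eq_iff[of y "scale l b"] by (simp add: eigenspace_iff F_closed b_in)
    then show "y \<in> span {b}"
      by (simp add: span_base span_scale)
  qed
  show "span {b} \<subseteq> eigenspace 0"
    by (rule span_minimal[OF _ subspace_eigenspace]) (simp add: eigenspace_def b_in bracket_self)
qed

text \<open>The product of \<open>\<phi> y\<close> with any function from the opposite eigenspace is a scalar, since it comes from the
eigenspace of \<open>0\<close>. So that eigenspace is the line spanned by \<open>1 / \<phi> y\<close>.\<close>

lemma eigenspace_opposite_proportional: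
  assumes "l \<noteq> 0" "x \<in> eigenspace l" "x \<noteq> 0" "x' \<in> eigenspace l" "y \<in> eigenspace (- l)" "y \<noteq> 0"
  shows "x' \<in> span {x}"
proof -
  have "\<exists>c. \<kappa> c = \<kappa> (- 2 * l) * (\<phi> z * \<phi> y)" if z: "z \<in> eigenspace l" for z
  proof -
    obtain c where "bracket z y = scale c b"
      using bracket_eigenspace(1)[OF z assms(5)] by (auto simp: eigenspace_0 span_singleton)
    then show ?thesis
      using bracket_eigenspace(2)[OF z assms(5)] by (intro exI[of _ c]) (simp add: phi_scale phi_b)
  qed
  then obtain c c' where c: "\<kappa> c = \<kappa> (- 2 * l) * (\<phi> x * \<phi> y)" "\<kappa> c' = \<kappa> (- 2 * l) * (\<phi> x' * \<phi> y)"
    using assms(2,4) by blast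
  have "\<phi> x \<noteq> 0" "\<phi> y \<noteq> 0"
    using assms phi_eq_0 by (auto simp: eigenspace_iff)
  then have "\<kappa> c \<noteq> 0"
    using assms(1) by (simp add: c(1) kappa_eq_0_iff)
  then have "\<kappa> (c' / c) = \<kappa> c' / \<kappa> c"
    using kappa_mult[of "c' / c" c] by (cases "c = 0") (simp_all add: field_simps kappa_0)
  then have "\<kappa> (c' / c) = \<phi> x' / \<phi> x"
    using \<open>\<kappa> c \<noteq> 0\<close> \<open>\<phi> y \<noteq> 0\<close> unfolding c by (simp add: field_simps)
  then have "\<phi> x' = \<phi> (scale (c' / c) x)"
    using \<open>\<phi> x \<noteq> 0\<close> by (simp add: phi_scale)
  then have "x' = scale (c' / c) x"
    using assms(2,4) phi_eq_iff by (simp add: eigenspace_iff F_closed)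
  then show ?thesis
    by (simp add: span_base span_scale)
qed

text \<open>The product of nonzero functions of eigenvalues \<open>1\<close> and \<open>-1\<close> is a nonzero scalar, so \<open>[e, f]\<close> is a nonzero
multiple of \<open>b\<close> for every nonzero \<open>f\<close> in the eigenspace of \<open>-1\<close>, and rescaling gives a standard triple.\<close>

theorem semidirect_or_sl2_triple:
  "semidirect F (eigenspace 1) (span {b}) \<and> abelian (eigenspace 1)
   \<or> (\<exists>h e f. sl2_triple scale bracket h e f \<and> F = span {h, e, f})"
proof (cases "eigenspace (- 1) = {0}")
  case True
  have ab: "bracket x y = 0" if "x \<in> eigenspace 1" "y \<in> eigenspace 1" for x y
    using bracket_eigenspace[OF that] phi_eq_0 by (simp add: eigenspace_iff kappa_0)
  have sum: "\<exists>u c. x = u + scale c b \<and> u \<in> eigenspace 1" if x: "x \<in> F" for x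
    using x
  proof (rule eigenspace_decomposition)
    fix u v w
    assume "x = u + v + w" "u \<in> eigenspace 1" "v \<in> eigenspace 0" "w \<in> eigenspace (- 1)"
    then show ?thesis
      using True by (auto simp: eigenspace_0 span_singleton)
  qed
  have b_closed: "scale c b \<in> F" for c
    by (simp add: F_closed b_in)
  have "lie_ideal (eigenspace 1) F"
    unfolding lie_ideal_def
  proof (intro conjI ballI subspace_eigenspace)
    fix x a
    assume x: "x \<in> F" and a: "a \<in> eigenspace 1"
    obtain u c where "x = u + scale c b" "u \<in> eigenspace 1"
      using sum[OF x] by blast
    then have "bracket x a = scale c a"
      using ab[of u a] a by (simp add: bracket_add_left bracket_scale_left eigenspace_def)
    then show "bracket x a \<in> eigenspace 1"
      using a subspace_scale[OF subspace_eigenspace] by simp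
  qed (auto simp: eigenspace_def)
  moreover have "subalgebra (span {b})"
    using subspace_span[of "{b}"]
    by (auto simp: subalgebra_def span_singleton bracket_scale_left bracket_scale_right bracket_self
        intro: range_eqI[of _ _ 0])
  moreover have "eigenspace 1 \<inter> span {b} = {0}"
    using subspace_0[OF subspace_eigenspace] by (auto simp: eigenspace_0[symmetric]) (simp add: eigenspace_def)
  moreover have "F = {a + c |a c. a \<in> eigenspace 1 \<and> c \<in> span {b}}"
  proof
    show "F \<subseteq> {a + c |a c. a \<in> eigenspace 1 \<and> c \<in> span {b}}"
      using sum unfolding span_singleton by blast
  qed (use b_closed in \<open>auto simp: span_singleton eigenspace_def F_closed\<close>)
  ultimately show ?thesis
    using ab b_closed by (auto simp: semidirect_def abelian_def span_singleton)
next
  case False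
  then obtain f0 where f0: "f0 \<in> eigenspace (- 1)" "f0 \<noteq> 0"
    using subspace_0[OF subspace_eigenspace] by blast
  have "bracket e f0 \<in> eigenspace 0"
    using bracket_eigenspace(1)[OF e_in f0(1)] by simp
  then obtain c where c: "bracket e f0 = scale c b"
    by (auto simp: eigenspace_0 span_singleton)
  have "\<phi> e \<noteq> 0" "\<phi> f0 \<noteq> 0"
    using e_in e_nonzero f0 phi_eq_0 by (auto simp: eigenspace_iff)
  then have "\<phi> (bracket e f0) \<noteq> 0"
    using bracket_eigenspace(2)[OF e_in f0(1)] by (simp add: kappa_eq_0_iff)
  then have "c \<noteq> 0"
    by (auto simp: c phi_0)
  \<comment> \<open>\<open>ad b\<close> has eigenvalues \<open>1\<close> and \<open>-1\<close>, half of those of the standard \<open>h\<close>\<close>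
  define h where "h = scale 2 b"
  define f where "f = scale (2 / c) f0"
  have f: "f \<in> eigenspace (- 1)" "f \<noteq> 0"
    using f0 \<open>c \<noteq> 0\<close> by (simp_all add: f_def subspace_scale[OF subspace_eigenspace])
  have "sl2_triple scale bracket h e f"
  proof
    show "bracket e f = h"
      using \<open>c \<noteq> 0\<close> by (simp add: f_def h_def bracket_scale_right c)
    show "bracket h e = scale 2 e" "bracket h f = scale (- 2) f"
      using e_in f(1) by (simp_all add: h_def eigenspace_def bracket_scale_left)
  qed (simp_all add: e_nonzero)
  moreover have "F = span {h, e, f}"
  proof
    show "span {h, e, f} \<subseteq> F"
      using e_in f(1) by (intro span_minimal subspace_F) (simp add: h_def eigenspace_def F_closed b_in)
    show "F \<subseteq> span {h, e, f}"
    proof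
      fix x
      assume "x \<in> F"
      then obtain u v w where uvw: "x = u + v + w" "u \<in> eigenspace 1" "v \<in> eigenspace 0" "w \<in> eigenspace (- 1)"
        by (rule eigenspace_decomposition)
      have "u \<in> span {e}" "w \<in> span {f}"
        using eigenspace_opposite_proportional[of 1 e u f] eigenspace_opposite_proportional[of "- 1" f w e]
          e_in e_nonzero f uvw by simp_all
      moreover have "v \<in> span {h}"
      proof -
        obtain c where "v = scale c b"
          using uvw(3) by (auto simp: eigenspace_0 span_singleton)
        then have "v = scale (c / 2) h"
          by (simp add: h_def)
        then show ?thesis
          by (simp add: span_base span_scale)
      qed
      moreover have "span {e} \<subseteq> span {h, e, f}" "span {f} \<subseteq> span {h, e, f}" "span {h} \<subseteq> span {h, e, f}"
        by (simp_all add: span_mono)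
      ultimately show "x \<in> span {h, e, f}"
        unfolding uvw(1) by (intro span_add) auto
    qed
  qed
  ultimately show ?thesis by blast
qed

end

text \<open>Two changes of base: first to an \<open>a\<close> that is not central, to find \<open>b\<close> with an eigenvector for \<open>1\<close>; then to
this \<open>b\<close>.\<close>

theorem (in line_algebra) classification:
  "abelian F
   \<or> (\<exists>A b. b \<in> F \<and> b \<noteq> 0 \<and> semidirect F A (span {b}) \<and> abelian A \<and> (\<forall>a\<in>A. bracket b a = a))
   \<or> (\<exists>h e f. sl2_triple scale bracket h e f \<and> F = span {h, e, f})"
proof (cases "abelian F")
  case False
  then obtain a y where a: "a \<in> F" "y \<in> F" "bracket a y \<noteq> 0"
    by (auto simp: abelian_def)
  have based: "based_line_algebra scale bracket F \<kappa> (\<lambda>q. \<phi> a * \<delta> q) (\<lambda>x. \<phi> x / \<phi> a) a"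
    if "a \<in> F" "a \<noteq> 0" for a
  proof -
    interpret line_algebra scale bracket F \<kappa> "\<lambda>q. \<phi> a * \<delta> q" "\<lambda>x. \<phi> x / \<phi> a"
      by (rule line_algebra_rebase[OF that])
    show ?thesis
      by unfold_locales (use that phi_eq_0 in auto)
  qed
  have "a \<noteq> 0"
    using a(3) by (auto simp: bracket_0)
  interpret a: based_line_algebra scale bracket F \<kappa> "\<lambda>q. \<phi> a * \<delta> q" "\<lambda>x. \<phi> x / \<phi> a" a
    by (rule based[OF a(1) \<open>a \<noteq> 0\<close>])
  obtain b e where be: "b \<in> F" "e \<in> F" "e \<noteq> 0" "bracket b e = e"
    using a.ex_ad_fixed_vector[OF a(2,3)] by blast
  then have "b \<noteq> 0"
    by (auto simp: bracket_0)
  interpret b: based_line_algebra scale bracket F \<kappa> "\<lambda>q. \<phi> b * \<delta> q" "\<lambda>x. \<phi> x / \<phi> b" b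
    by (rule based[OF be(1) \<open>b \<noteq> 0\<close>])
  interpret b: split_line_algebra scale bracket F \<kappa> "\<lambda>q. \<phi> b * \<delta> q" "\<lambda>x. \<phi> x / \<phi> b" b e
    by unfold_locales (use be in \<open>auto simp: b.eigenspace_def\<close>)
  have "\<forall>a\<in>b.eigenspace 1. bracket b a = a"
    by (simp add: b.eigenspace_def)
  then show ?thesis
    using b.semidirect_or_sl2_triple be(1) \<open>b \<noteq> 0\<close> by blast
qed simp

section \<open>Polynomials form an integral domain\<close>

text \<open>The product of leading terms cannot cancel. Monomials are compared through an additive embedding \<open>h\<close> into
an ordered monoid, because exponent vectors over an arbitrary finite index type carry no canonical
order; a numbering of the variables supplies the embedding below.\<close>

lemma poly_mapping_mult_nonzero:
  fixes h :: "'a::cancel_comm_monoid_add \<Rightarrow> 'c::linordered_cancel_ab_semigroup_add"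
    and p q :: "'a \<Rightarrow>\<^sub>0 'b::semiring_no_zero_divisors"
  assumes h: "inj h" "\<And>x y. h (x + y) = h x + h y"
    and "p \<noteq> 0" "q \<noteq> 0"
  shows "p * q \<noteq> 0"
proof -
  have ex_max: "\<exists>m\<in>Poly_Mapping.keys r. \<forall>k\<in>Poly_Mapping.keys r. h k \<le> h m" if "r \<noteq> 0" for r :: "'a \<Rightarrow>\<^sub>0 'b"
    using that Max_in[of "h ` Poly_Mapping.keys r"] Max_ge[of "h ` Poly_Mapping.keys r"] by fastforce
  obtain a where a: "a \<in> Poly_Mapping.keys p" "\<And>k. k \<in> Poly_Mapping.keys p \<Longrightarrow> h k \<le> h a"
    using ex_max[OF \<open>p \<noteq> 0\<close>] by blast
  obtain b where b: "b \<in> Poly_Mapping.keys q" "\<And>k. k \<in> Poly_Mapping.keys q \<Longrightarrow> h k \<le> h b"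
    using ex_max[OF \<open>q \<noteq> 0\<close>] by blast
  have only_max: "k = a \<and> l = b" if "k \<in> Poly_Mapping.keys p" "l \<in> Poly_Mapping.keys q" "a + b = k + l" for k l
  proof -
    have "h k = h a"
      using a(2)[OF that(1)] b(2)[OF that(2)] h(2) that(3)
      by (metis add_le_less_mono add_less_le_mono less_irrefl order_le_less)
    then show ?thesis
      using h(1) that(3) by (auto simp: inj_eq)
  qed
  have "Poly_Mapping.lookup p k * (\<Sum>l. Poly_Mapping.lookup q l when a + b = k + l) = (Poly_Mapping.lookup p a * Poly_Mapping.lookup q b when k = a)" for k
  proof (cases "k \<in> Poly_Mapping.keys p")
    case True
    have "(Poly_Mapping.lookup q l when a + b = k + l) = ((Poly_Mapping.lookup q b when k = a) when l = b)" for l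
      using only_max[OF True, of l] by (cases "l \<in> Poly_Mapping.keys q") (auto simp: when_def in_keys_iff)
    then show ?thesis
      by (simp add: when_def)
  next
    case False
    then show ?thesis
      using a(1) by (auto simp: when_def in_keys_iff)
  qed
  then have "Poly_Mapping.lookup (p * q) (a + b) = Poly_Mapping.lookup p a * Poly_Mapping.lookup q b"
    by (simp add: lookup_mult)
  then have "Poly_Mapping.lookup (p * q) (a + b) \<noteq> 0"
    using a(1) b(1) by (simp add: in_keys_iff)
  then show ?thesis
    by auto
qed

definition renumber :: "('n::finite \<Rightarrow>\<^sub>0 nat) \<Rightarrow> (nat \<Rightarrow>\<^sub>0 nat)" where
  "renumber e = (\<Sum>i\<in>UNIV. Poly_Mapping.single (to_nat i) (Poly_Mapping.lookup e i))"

lemma renumber_add: "renumber (d + e) = renumber d + renumber e"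
  by (simp add: renumber_def lookup_add single_add sum.distrib)

lemma inj_renumber: "inj renumber"
proof (rule injI, rule poly_mapping_eqI)
  fix d e :: "'n::finite \<Rightarrow>\<^sub>0 nat" and i
  have "Poly_Mapping.lookup (renumber c) (to_nat i) = Poly_Mapping.lookup c i" for c :: "'n \<Rightarrow>\<^sub>0 nat"
    by (simp add: renumber_def lookup_sum lookup_single when_def)
  then show "renumber d = renumber e \<Longrightarrow> Poly_Mapping.lookup d i = Poly_Mapping.lookup e i"
    by metis
qed

lemma mpoly_mult_nonzero: "p \<noteq> 0 \<Longrightarrow> q \<noteq> 0 \<Longrightarrow> p * q \<noteq> 0" for p q :: "('n::finite, 'k::field) mpoly"
  by (rule poly_mapping_mult_nonzero[OF inj_renumber renumber_add])

text \<open>Integrality of the polynomial ring rests on a chosen numbering of the variables, so it becomes a class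
instance on a copy of the ring. The fraction field is formed over this copy.\<close>

typedef (overloaded) ('n, 'k) mpoly_domain = "UNIV :: ('n::finite, 'k::field) mpoly set"
  morphisms of_domain to_domain ..

setup_lifting type_definition_mpoly_domain

instantiation mpoly_domain :: (finite, field) idom
begin

lift_definition zero_mpoly_domain :: "('a, 'b) mpoly_domain" is 0 .
lift_definition one_mpoly_domain :: "('a, 'b) mpoly_domain" is 1 .
lift_definition plus_mpoly_domain ::
  "('a, 'b) mpoly_domain \<Rightarrow> ('a, 'b) mpoly_domain \<Rightarrow> ('a, 'b) mpoly_domain" is "(+)" .
lift_definition minus_mpoly_domain ::
  "('a, 'b) mpoly_domain \<Rightarrow> ('a, 'b) mpoly_domain \<Rightarrow> ('a, 'b) mpoly_domain" is "(-)" .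
lift_definition uminus_mpoly_domain :: "('a, 'b) mpoly_domain \<Rightarrow> ('a, 'b) mpoly_domain" is uminus .
lift_definition times_mpoly_domain ::
  "('a, 'b) mpoly_domain \<Rightarrow> ('a, 'b) mpoly_domain \<Rightarrow> ('a, 'b) mpoly_domain" is "(*)" .

instance
  by standard (transfer; simp add: algebra_simps mpoly_mult_nonzero)+

end

lemma to_domain_simps:
  "to_domain (p + q) = to_domain p + to_domain q" "to_domain (p - q) = to_domain p - to_domain q"
  "to_domain (p * q) = to_domain p * to_domain q" "to_domain 1 = 1"
  "to_domain p = 0 \<longleftrightarrow> p = 0"
  by (simp_all add: zero_mpoly_domain_def one_mpoly_domain_def plus_mpoly_domain_def
      minus_mpoly_domain_def times_mpoly_domain_def to_domain_inverse to_domain_inject)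

section \<open>Derivations of a fraction field\<close>

text \<open>The quotient rule, read off an arbitrary representation as a fraction; independence of the
representation holds once \<open>d\<close> is a derivation.\<close>

definition fract_derivation :: "('a::idom \<Rightarrow> 'a) \<Rightarrow> 'a fract \<Rightarrow> 'a fract" where
  "fract_derivation d r =
     (SOME s. \<exists>a b. b \<noteq> 0 \<and> r = Fract a b \<and> s = Fract (d a * b - a * d b) (b * b))"

context
  fixes d :: "'a::idom \<Rightarrow> 'a"
  assumes d_add: "d (a + b) = d a + d b" and d_mult: "d (a * b) = d a * b + a * d b"
begin

lemma fract_derivation_Fract:
  assumes "b \<noteq> 0"
  shows "fract_derivation d (Fract a b) = Fract (d a * b - a * d b) (b * b)"
  unfolding fract_derivation_def
proof (rule some_equality)
  fix s
  assume "\<exists>a' b'. b' \<noteq> 0 \<and> Fract a b = Fract a' b' \<and> s = Fract (d a' * b' - a' * d b') (b' * b')"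
  then obtain a' b' where s: "b' \<noteq> 0" "Fract a b = Fract a' b'"
    "s = Fract (d a' * b' - a' * d b') (b' * b')"
    by blast
  have 1: "a * b' = a' * b"
    using s(1,2) assms by (simp add: eq_fract)
  then have 2: "d a * b' + a * d b' = d a' * b + a' * d b"
    using d_mult by metis
  \<comment> \<open>apply \<open>d\<close> to the equation \<open>a b' = a' b\<close> and multiply by \<open>b b'\<close>\<close>
  have "(d a' * b' - a' * d b') * (b * b) = (d a * b - a * d b) * (b' * b')"
    using 1 2 by algebra
  then show "s = Fract (d a * b - a * d b) (b * b)"
    using s(1,3) assms by (simp add: eq_fract)
qed (use assms in blast)

lemma fract_derivation_add:
  "fract_derivation d (r + s) = fract_derivation d r + fract_derivation d s"
proof (cases r rule: Fract_cases; cases s rule: Fract_cases)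
  fix a b a' b'
  assume r: "r = Fract a b" "b \<noteq> 0" and s: "s = Fract a' b'" "b' \<noteq> 0"
  have "(d (a * b' + a' * b) * (b * b') - (a * b' + a' * b) * d (b * b')) * ((b * b) * (b' * b')) =
     ((d a * b - a * d b) * (b' * b') + (d a' * b' - a' * d b') * (b * b)) * ((b * b') * (b * b'))"
    unfolding d_mult d_add by algebra
  then show ?thesis
    using r s by (simp add: fract_derivation_Fract eq_fract)
qed

lemma fract_derivation_mult:
  "fract_derivation d (r * s) = fract_derivation d r * s + r * fract_derivation d s"
proof (cases r rule: Fract_cases; cases s rule: Fract_cases)
  fix a b a' b'
  assume r: "r = Fract a b" "b \<noteq> 0" and s: "s = Fract a' b'" "b' \<noteq> 0"
  have "(d (a * a') * (b * b') - (a * a') * d (b * b')) * ((b * b * b') * (b * (b' * b'))) =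
     ((d a * b - a * d b) * a' * (b * (b' * b')) + a * (d a' * b' - a' * d b') * (b * b * b'))
       * ((b * b') * (b * b'))"
    unfolding d_mult by algebra
  then show ?thesis
    using r s by (simp add: fract_derivation_Fract eq_fract)
qed

lemma fract_derivation_integral: "fract_derivation d (Fract a 1) = Fract (d a) 1"
proof -
  have "d 1 = 0"
    using d_mult[of 1 1] by (simp only: mult_1_left mult_1_right add_cancel_right_right)
  then show ?thesis
    by (simp add: fract_derivation_Fract)
qed

end

section \<open>Polynomial Lie algebras of rank one\<close>

text \<open>Two elements of \<open>L\<close> satisfy a nontrivial relation \<open>u D + v x = 0\<close> over the polynomials, and \<open>v \<noteq> 0\<close>
because \<open>D\<close> alone is independent. Cancelling \<open>v\<close> leaves \<open>x q \<cdot> D p = x p \<cdot> D q\<close>, the proportionality of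
\<open>x\<close> and \<open>D\<close> without the coefficients.\<close>

lemma rank_one_proportional:
  fixes L :: "('n::finite, 'k::field) derivation set"
  assumes "has_rank L 1"
  obtains D p where "der_apply D p \<noteq> 0"
    and "\<And>x q. x \<in> L \<Longrightarrow> der_apply x q * der_apply D p = der_apply x p * der_apply D q"
proof -
  obtain D where D: "D \<in> L" "W_mod.independent {D}"
    using assms by (auto simp: has_rank_def card_1_singleton_iff)
  have "D \<noteq> 0"
    using D(2) W_mod.dependent_zero by blast
  then obtain p where p: "der_apply D p \<noteq> 0"
    by (auto simp: derivation_eq_iff der_apply_ops)
  have "der_apply x q * der_apply D p = der_apply x p * der_apply D q" if "x \<in> L" for x q
  proof (cases "x = D")
    case False
    have "W_mod.dependent {D, x}"
    proof (rule ccontr)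
      assume "W_mod.independent {D, x}"
      then have "card {D, x} \<le> 1"
        using assms D(1) that unfolding has_rank_def
        by (metis empty_subsetI finite.emptyI finite_insert insert_subset)
      then show False
        using False by simp
    qed
    then obtain u where u: "u D \<noteq> 0 \<or> u x \<noteq> 0" "poly_scale (u D) D + poly_scale (u x) x = 0"
      using False by (auto simp: W_mod.dependent_finite)
    have "u x \<noteq> 0"
    proof
      assume "u x = 0"
      then have "u D \<noteq> 0" "(\<Sum>v\<in>{D}. poly_scale (u v) v) = 0"
        using u by simp_all
      then show False
        using D(2) by (auto simp: W_mod.dependent_finite)
    qed
    have cancel: "u x * der_apply x r = - (u D * der_apply D r)" for r
      using arg_cong[OF u(2), of "\<lambda>E. der_apply E r"]
      by (simp add: der_apply_ops eq_neg_iff_add_eq_0 add.commute)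
    have "u x * (der_apply x q * der_apply D p - der_apply x p * der_apply D q) = 0"
      unfolding right_diff_distrib mult.assoc[symmetric] cancel by (simp add: mult_ac)
    then show ?thesis
      using \<open>u x \<noteq> 0\<close> mpoly_mult_nonzero by (metis right_minus_eq)
  qed simp
  then show thesis
    using p that by blast
qed

text \<open>Any polynomial \<open>p\<close> with \<open>D p \<noteq> 0\<close> reads off the proportionality factor of \<open>x\<close> and \<open>D\<close> as the quotient
\<open>x p / D p\<close>. This makes the factor visibly linear in \<open>x\<close>, and evaluating the commutator at \<open>p\<close> shows that
it turns brackets into Wronskians.\<close>

lemma line_algebra_of_derivations:
  fixes D :: "('n::finite, 'k::{alg_closed_field, field_char_0}) derivation"
  defines "emb \<equiv> \<lambda>q. Fract (to_domain q) 1"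
  assumes p: "der_apply D p \<noteq> 0"
    and proportional: "\<And>x q. x \<in> F \<Longrightarrow> der_apply x q * der_apply D p = der_apply x p * der_apply D q"
    and F: "W.subalgebra F" "W.finite_dim F"
  shows "line_algebra der_scale der_bracket F (\<lambda>c. emb (Const c))
     (fract_derivation (\<lambda>r. to_domain (der_apply D (of_domain r))))
     (\<lambda>x. emb (der_apply x p) / emb (der_apply D p))"
proof -
  define d where "d = (\<lambda>r. to_domain (der_apply D (of_domain r)))"
  define \<phi> where "\<phi> x = emb (der_apply x p) / emb (der_apply D p)" for x
  let ?\<delta> = "fract_derivation d"
  have emb: "emb (a + b) = emb a + emb b" "emb (a - b) = emb a - emb b" "emb (a * b) = emb a * emb b"
    "emb 1 = 1" "emb a = 0 \<longleftrightarrow> a = 0" for a b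
    by (simp_all add: emb_def to_domain_simps)
      (simp_all add: One_fract_def Zero_fract_def eq_fract to_domain_simps)
  have d: "d (a + b) = d a + d b" "d (a * b) = d a * b + a * d b" for a b
    by (simp_all add: d_def plus_mpoly_domain.rep_eq times_mpoly_domain.rep_eq der_apply_simps(1,3)
        to_domain_simps of_domain_inverse)
  have \<delta>_emb: "?\<delta> (emb q) = emb (der_apply D q)" for q
    using fract_derivation_integral[of d, OF d] by (simp add: emb_def d_def to_domain_inverse)
  have dp: "emb (der_apply D p) \<noteq> 0"
    using p by (simp add: emb)
  have apply_p: "emb (der_apply x p) = \<phi> x * emb (der_apply D p)" for x
    using dp by (simp add: \<phi>_def)
  \<comment> \<open>on the fraction field, \<open>x\<close> acts as the multiple \<open>\<phi> x\<close> of \<open>D\<close>\<close>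
  have acts: "emb (der_apply x q) = \<phi> x * ?\<delta> (emb q)" if "x \<in> F" for x q
    using arg_cong[OF proportional[OF that, of q], of emb] dp by (simp add: \<phi>_def \<delta>_emb emb field_simps)
  have \<delta>_mult: "?\<delta> (r * s) = ?\<delta> r * s + r * ?\<delta> s" for r s
    by (rule fract_derivation_mult[of d, OF d])
  have "line_algebra der_scale der_bracket F (\<lambda>c. emb (Const c)) ?\<delta> \<phi>"
  proof
    show "x = 0" if "x \<in> F" "\<phi> x = 0" for x
    proof -
      have "emb (der_apply x q) = 0" for q
        using acts[OF that(1)] that(2) by simp
      then show ?thesis
        by (simp add: emb derivation_eq_iff der_apply_ops)
    qed
    show "\<phi> (der_bracket x y) = \<phi> x * ?\<delta> (\<phi> y) - \<phi> y * ?\<delta> (\<phi> x)" if "x \<in> F" "y \<in> F" for x y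
    proof -
      have "\<phi> (der_bracket x y) * emb (der_apply D p) =
          emb (der_apply x (der_apply y p)) - emb (der_apply y (der_apply x p))"
        by (simp add: der_bracket.rep_eq emb flip: apply_p)
      also have "\<dots> = \<phi> x * ?\<delta> (\<phi> y * emb (der_apply D p)) - \<phi> y * ?\<delta> (\<phi> x * emb (der_apply D p))"
        by (simp add: acts that flip: apply_p)
      also have "\<dots> = (\<phi> x * ?\<delta> (\<phi> y) - \<phi> y * ?\<delta> (\<phi> x)) * emb (der_apply D p)"
        by (simp add: \<delta>_mult algebra_simps)
      finally show ?thesis
        using dp by simp
    qed
    show "?\<delta> (r + s) = ?\<delta> r + ?\<delta> s" for r s
      by (rule fract_derivation_add[of d, OF d])
  qed (simp_all add: F \<delta>_mult \<delta>_emb emb \<phi>_def Const_simps der_apply_ops der_apply_Const add_divide_distrib)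
  then show ?thesis
    by (simp add: d_def \<phi>_def[abs_def])
qed

theorem theorem1:
  fixes L F :: "('n::finite, 'k::{alg_closed_field, field_char_0}) derivation set"
  assumes "polynomial_lie_algebra L"
    and "has_rank L 1"
    and "F \<subseteq> L"
    and "W.subalgebra F"
    and "W.finite_dim F"
  shows "W.abelian F
    \<or> (\<exists>A b. b \<in> F \<and> b \<noteq> 0 \<and> W.semidirect F A (W.span {b}) \<and> W.abelian A \<and>
          (\<forall>a\<in>A. der_bracket b a = a))
    \<or> (W.dim F = 3 \<and> W.simple F \<and>
       lie_isomorphic der_scale der_bracket F mat_scale mat_bracket (sl2 :: ('k^2^2) set))"
proof -
  obtain D p where "der_apply D p \<noteq> 0"
    and "\<And>x q. x \<in> L \<Longrightarrow> der_apply x q * der_apply D p = der_apply x p * der_apply D q"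
    using rank_one_proportional[OF assms(2)] by blast
  then have "line_algebra der_scale der_bracket F (\<lambda>c. Fract (to_domain (Const c)) 1)
     (fract_derivation (\<lambda>r. to_domain (der_apply D (of_domain r))))
     (\<lambda>x. Fract (to_domain (der_apply x p)) 1 / Fract (to_domain (der_apply D p)) 1)"
    using assms(3-5) by (intro line_algebra_of_derivations) auto
  from line_algebra.classification[OF this] show ?thesis
  proof (elim disjE)
    assume "\<exists>h e f. sl2_triple der_scale der_bracket h e f \<and> F = W.span {h, e, f}"
    then obtain h e f where triple: "sl2_triple der_scale der_bracket h e f" and "F = W.span {h, e, f}"
      by (elim exE conjE)
    then show ?thesis
      using sl2_triple.dim_eq_3[OF triple] sl2_triple.simple_span[OF triple]
        sl2_triple.isomorphic_sl2[OF triple] by simp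
  qed simp_all
qed

end
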